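(* Let $2\le k\le n-1$, let $H:(-\varepsilon_0,\varepsilon_0)\to\mathrm{Herm}(n)$ be real-analytic with $H(0)\in\Sigma_k$, and let $r=\mathrm{ord}_0\big(t\mapsto D_k(H(t))\big)$ be the order of energy splitting (computed from the power series with which $D_k(H(t))$ coincides for small $t\ge0$). Let $H_0'\in\Sigma_k$ be any diagonal matrix with nondecreasing diagonal entries such that $H(t)\in\mathcal V_0'$ (the domain of the SW decomposition with respect to $H_0'$) for all $|t|<\delta$, some $\delta>0$, and let $H_{\mathrm{eff}}(t)$ be the effective Hamiltonian of $H(t)$ with respect to $H_0'$, with coordinates $y_1(t),\dots,y_{k^2-1}(t)$. Then $$r=\mathrm{ord}_0\big(t\mapsto d(H(t),\Sigma_k)\big)=\mathrm{ord}_0\big(t\mapsto H_{\mathrm{eff}}(t)\big)=\min_{1\le j\le k^2-1}\mathrm{ord}_0\big(t\mapsto y_j(t)\big).$$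
   Context: $\mathrm{Herm}(n)$: $n\times n$ complex Hermitian matrices, Frobenius norm $\|H\|=\sqrt{\mathrm{tr}H^2}$, $d(H,G)=\|H-G\|$, $d(H,A)=\inf_{G\in A}d(H,G)$. Eigenvalues $\lambda_1(H)\le\dots\le\lambda_n(H)$; $\Sigma_k=\{H:\lambda_1=\dots=\lambda_k<\lambda_{k+1}\}$; $D_k(H)=\sqrt{\frac1k\sum_{j=1}^k(\lambda_j-\bar\lambda)^2}$ with $\bar\lambda=\frac1k\sum_{j\le k}\lambda_j$. For a function $g$ coinciding on $[0,\varepsilon)$ with a convergent power series $\sum a_mt^m$, $\mathrm{ord}_0(g)=\min\{m:a_m\ne0\}$ ($\infty$ if none); for a matrix-valued function the order is the minimum of the orders of its entries. A matrix is block diagonal if $M_{ab}=0$ whenever $a\le k<b$ or $b\le k<a$, and off-block if $M_{ab}=0$ whenever $a,b\le k$ or $a,b>k$. SW decomposition: for a diagonal $H_0\in\Sigma_k$ with nondecreasing diagonal, there are open neighborhoods $\mathcal V_0$ of $H_0$ and $\mathcal U_0$ of $(0,0)$ in the space of pairs ($S$ off-block Hermitian, $\breve B$ block-diagonal Hermitian) such that every $H\in\mathcal V_0$ can be written uniquely as $H=e^{iS}(H_0+\breve B)e^{-iS}$ with $(S,\breve B)\in\mathcal U_0$, where the first $k$ columns of $e^{iS}$ span the sum of the eigenspaces of $H$ for its lowest $k$ eigenvalues; $S,\breve B$ depend real-analytically on $H$. Writing $\breve B=B+T+H_{\mathrm{eff}}$ with $B$ supported in the lower-right $(n-k)\times(n-k)$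 block, $T=c\,\mathrm{diag}(1,\dots,1,0,\dots,0)$ ($k$ ones), and $H_{\mathrm{eff}}$ supported in the upper-left $k\times k$ block with trace $0$, $H_{\mathrm{eff}}$ is the effective Hamiltonian; $y_1,\dots,y_{k^2-1}$ are its coordinates in a fixed orthonormal (Frobenius) basis of the traceless Hermitian matrices supported in the upper-left $k\times k$ block. *)

theory Defs
  imports "HOL-Analysis.Analysis" "HOL-Computational_Algebra.Polynomial"
    "HOL-Computational_Algebra.Fundamental_Theorem_Algebra"
begin

text \<open>Matrices in Herm(n) are rendered as complex^'n^'n, where the finite index type 'n
  carries a linear order; the position of an index a (0-based) is idx a.  The library norm
  on complex^'n^'n is the Frobenius norm (square root of the sum of squared moduli of the
  entries), which equals sqrt (tr H^2) on Hermitian matrices.\<close>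

type_synonym 'n cmat = "complex^'n^'n"

definition idx :: "'n::{finite,linorder} \<Rightarrow> nat" where
  "idx a = card {b. b < a}"

definition herm :: "'n::finite cmat \<Rightarrow> bool" where
  "herm M \<longleftrightarrow> (\<forall>i j. M $ i $ j = cnj (M $ j $ i))"

definition Herm :: "'n::finite cmat set" where
  "Herm = {M. herm M}"

definition char_poly :: "'n::finite cmat \<Rightarrow> complex poly" where
  "char_poly A = det (\<chi> i j. (if i = j then [:0, 1:] else 0) - [:A $ i $ j:])"

definition eigvals :: "'n::finite cmat \<Rightarrow> real list" where
  "eigvals H = sorted_list_of_multiset (image_mset Re (proots (char_poly H)))"

definition lam :: "'n::finite cmat \<Rightarrow> nat \<Rightarrow> real" where
  "lam H j = eigvals H ! (j - 1)"

definition Sigma :: "nat \<Rightarrow> 'n::finite cmat set" where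
  "Sigma k = {H. herm H \<and> (\<forall>j\<in>{1..k}. lam H j = lam H 1) \<and> lam H k < lam H (k + 1)}"

definition Dk :: "nat \<Rightarrow> 'n::finite cmat \<Rightarrow> real" where
  "Dk k H = (let m = (\<Sum>j=1..k. lam H j) / real k
             in sqrt ((\<Sum>j=1..k. (lam H j - m)\<^sup>2) / real k))"

definition has_ps_at0 :: "(real \<Rightarrow> 'a::real_normed_vector) \<Rightarrow> (nat \<Rightarrow> 'a) \<Rightarrow> bool" where
  "has_ps_at0 g a \<longleftrightarrow> (\<exists>eps>0. \<forall>t\<in>{0..<eps}. (\<lambda>m. t ^ m *\<^sub>R a m) sums g t)"

definition ord0 :: "(real \<Rightarrow> 'a::real_normed_vector) \<Rightarrow> enat" where
  "ord0 g = (let a = (SOME a. has_ps_at0 g a) in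
             if \<forall>m. a m = 0 then \<infinity> else enat (LEAST m. a m \<noteq> 0))"

definition ord0_mat :: "(real \<Rightarrow> 'n::finite cmat) \<Rightarrow> enat" where
  "ord0_mat M = Min {ord0 (\<lambda>t. M t $ i $ j) | i j. True}"

definition real_analytic_on1 :: "real set \<Rightarrow> (real \<Rightarrow> 'a::real_normed_vector) \<Rightarrow> bool" where
  "real_analytic_on1 I f \<longleftrightarrow> (\<forall>t0\<in>I. \<exists>a r. r > 0 \<and>
     (\<forall>t. \<bar>t - t0\<bar> < r \<longrightarrow> (\<lambda>m. (t - t0) ^ m *\<^sub>R a m) sums f t))"

definition real_analytic_on_in ::
  "'a::euclidean_space set \<Rightarrow> 'a set \<Rightarrow> ('a \<Rightarrow> 'b::real_normed_vector) \<Rightarrow> bool" where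
  "real_analytic_on_in L V f \<longleftrightarrow> (\<forall>x\<in>V. \<exists>c r. r > 0 \<and>
     (\<forall>y\<in>ball x r \<inter> L.
        ((\<lambda>\<alpha>. (\<Prod>b\<in>Basis. ((y - x) \<bullet> b) ^ \<alpha> b) *\<^sub>R c \<alpha>) has_sum f y)
          {\<alpha> :: 'a \<Rightarrow> nat. \<forall>b. b \<notin> Basis \<longrightarrow> \<alpha> b = 0}))"

definition block_diag :: "nat \<Rightarrow> 'n::{finite,linorder} cmat \<Rightarrow> bool" where
  "block_diag k M \<longleftrightarrow> (\<forall>a b. (idx a < k) \<noteq> (idx b < k) \<longrightarrow> M $ a $ b = 0)"

definition off_block :: "nat \<Rightarrow> 'n::{finite,linorder} cmat \<Rightarrow> bool" where
  "off_block k M \<longleftrightarrow> (\<forall>a b. (idx a < k) = (idx b < k) \<longrightarrow> M $ a $ b = 0)"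

definition upper_left :: "nat \<Rightarrow> 'n::{finite,linorder} cmat \<Rightarrow> bool" where
  "upper_left k M \<longleftrightarrow> (\<forall>a b. \<not> (idx a < k \<and> idx b < k) \<longrightarrow> M $ a $ b = 0)"

definition lower_right :: "nat \<Rightarrow> 'n::{finite,linorder} cmat \<Rightarrow> bool" where
  "lower_right k M \<longleftrightarrow> (\<forall>a b. \<not> (\<not> idx a < k \<and> \<not> idx b < k) \<longrightarrow> M $ a $ b = 0)"

definition is_diag :: "'n::finite cmat \<Rightarrow> bool" where
  "is_diag M \<longleftrightarrow> (\<forall>a b. a \<noteq> b \<longrightarrow> M $ a $ b = 0)"

definition mtrace :: "'n::finite cmat \<Rightarrow> complex" where
  "mtrace M = (\<Sum>a\<in>UNIV. M $ a $ a)"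

primrec mpow :: "'n::finite cmat \<Rightarrow> nat \<Rightarrow> 'n cmat" where
  "mpow A 0 = mat 1"
| "mpow A (Suc m) = A ** mpow A m"

definition mexp :: "'n::finite cmat \<Rightarrow> 'n cmat" where
  "mexp A = (\<Sum>m. (1 / fact m) *\<^sub>R mpow A m)"

definition cscale :: "complex \<Rightarrow> 'n::finite cmat \<Rightarrow> 'n cmat" where
  "cscale c M = (\<chi> a b. c * M $ a $ b)"

definition low_spec :: "nat \<Rightarrow> 'n::finite cmat \<Rightarrow> (complex^'n::finite) set" where
  "low_spec k H = {v. \<exists>w :: nat \<Rightarrow> complex^'n.
      (\<forall>j\<in>{1..k}. H *v w j = (\<chi> i. complex_of_real (lam H j) * w j $ i))
      \<and> v = (\<Sum>j=1..k. w j)}"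

definition first_cols_span :: "nat \<Rightarrow> 'n::{finite,linorder} cmat \<Rightarrow> (complex^'n::{finite,linorder}) set" where
  "first_cols_span k U = {v. \<exists>c :: 'n \<Rightarrow> complex.
      v = (\<chi> i. \<Sum>a\<in>{a. idx a < k}. U $ i $ a * c a)}"

definition SW_pairs :: "nat \<Rightarrow> ('n::{finite,linorder} cmat \<times> 'n cmat) set" where
  "SW_pairs k = {(S, B). herm S \<and> off_block k S \<and> herm B \<and> block_diag k B}"

definition SW_conj :: "'n::finite cmat \<Rightarrow> 'n cmat \<Rightarrow> 'n cmat \<Rightarrow> 'n cmat" where
  "SW_conj H0 S B = mexp (cscale \<i> S) ** (H0 + B) ** mexp (cscale (-\<i>) S)"

definition SW_data :: "nat \<Rightarrow> 'n::{finite,linorder} cmat \<Rightarrow> 'n cmat set \<Rightarrow>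
    ('n cmat \<times> 'n cmat) set \<Rightarrow> ('n cmat \<Rightarrow> 'n cmat) \<Rightarrow> ('n cmat \<Rightarrow> 'n cmat) \<Rightarrow> bool" where
  "SW_data k H0 V0 U0 Sf Bf \<longleftrightarrow>
     openin (top_of_set Herm) V0 \<and> H0 \<in> V0 \<and>
     openin (top_of_set (SW_pairs k)) U0 \<and> (0, 0) \<in> U0 \<and>
     (\<forall>H\<in>V0. (Sf H, Bf H) \<in> U0 \<and> H = SW_conj H0 (Sf H) (Bf H) \<and>
        first_cols_span k (mexp (cscale \<i> (Sf H))) = low_spec k H \<and>
        (\<forall>S B. (S, B) \<in> U0 \<and> H = SW_conj H0 S B \<longrightarrow> S = Sf H \<and> B = Bf H)) \<and>
     real_analytic_on_in Herm V0 Sf \<and> real_analytic_on_in Herm V0 Bf"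

definition eff_ham :: "nat \<Rightarrow> 'n::{finite,linorder} cmat \<Rightarrow> 'n cmat" where
  "eff_ham k Bb = (THE He. \<exists>B c. lower_right k B \<and> upper_left k He \<and> mtrace He = 0 \<and>
      Bb = B + (\<chi> a b. if a = b \<and> idx a < k then complex_of_real c else 0) + He)"

definition eff_space :: "nat \<Rightarrow> 'n::{finite,linorder} cmat set" where
  "eff_space k = {M. herm M \<and> upper_left k M \<and> mtrace M = 0}"

definition eff_ONB :: "nat \<Rightarrow> (nat \<Rightarrow> 'n::{finite,linorder} cmat) \<Rightarrow> bool" where
  "eff_ONB k E \<longleftrightarrow> (\<forall>j\<in>{1..k\<^sup>2-1}. E j \<in> eff_space k) \<and>
     (\<forall>i\<in>{1..k\<^sup>2-1}. \<forall>j\<in>{1..k\<^sup>2-1}. E i \<bullet> E j = (if i = j then 1 else 0)) \<and>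
     span (E ` {1..k\<^sup>2-1}) = eff_space k"

end

theory Submission
  imports Defs "HOL-Complex_Analysis.Complex_Analysis"
begin

text \<open>Writing H(t) = W (M1 + M2) W* with M1, M2 the diagonal blocks of H0' plus the SW block
  part, the condition on the first k columns of W says that M1 carries exactly the k lowest
  eigenvalues.  Since Heff is M1 minus its mean, k Dk(H)^2 = |Heff|^2; and |Heff| is also the
  distance to Sigma k once |Heff| is small against the gap: replacing M1 by its mean gives a point of
  Sigma k at that distance, and for any competitor with lowest eigenvalue e and eigenprojection P of
  rank k the distance is at least |(H - e) P|, which is minimal when P sits on the lowest k
  eigenvectors.  So near 0 all four quantities are comparable up to constants, and the order at 0 of
  a power series only depends on its growth.  Dk and the distance do have power series to the right
  of 0: |Heff|^2 is analytic and nonnegative on both sides of 0, hence vanishes to even order, and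
  its square root is a power of t times an analytic function.\<close>

text \<open>The spectral data \<open>W\<close>, \<open>U\<close>, \<open>m\<close> are picked for
  each t separately and may jump with t, so no regularity is ever read off them. Analyticity enters
  only through the entries of \<open>Bf (H t)\<close>, on which the effective Hamiltonian depends
  real-linearly. For the same reason the gap above the k lowest eigenvalues is not obtained from
  continuity of eigenvalues but from a perturbation bound that compares the lower block at t with
  the lower block at 0. The reference matrix \<open>H0'\<close> need not be \<open>H 0\<close>: the
  block part at 0 can be nonzero, and the vanishing of the effective Hamiltonian at 0 has to be
  deduced from \<open>H 0\<close> lying in \<open>Sigma k\<close>. Analyticity at 0 is carried as a
  holomorphic extension to a complex disc. Substituting a curve into a multivariate series then
  becomes a uniform limit of holomorphic functions, and extracting a square root becomes
  factorisation at a zero. Since \<open>ord0\<close> selects coefficients by SOME, it says nothing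
  about a function without a series; existence of a series to the right of 0 must be established for
  each quantity before growth can decide its order.\<close>

no_notation fps_nth (infixl "$" 75)

subsection \<open>Power series at 0 and growth\<close>

text \<open>Convergence at a single point s bounds all terms at s, and for t < s / 2 the tail is
  then dominated by a geometric series of ratio 1/2.\<close>

lemma has_ps_at0_remainder:
  fixes g :: "real \<Rightarrow> 'a::banach"
  assumes g: "has_ps_at0 g a" and low: "\<forall>j<i. a j = 0"
  shows "\<exists>C e. 0 < e \<and> (\<forall>t\<in>{0..<e}. norm (g t - t ^ i *\<^sub>R a i) \<le> C * t ^ Suc i)"
proof -
  obtain eps where eps: "eps > 0" and sm: "\<And>t. t \<in> {0..<eps} \<Longrightarrow> (\<lambda>m. t ^ m *\<^sub>R a m) sums g t"
    using g unfolding has_ps_at0_def by blast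
  define s where "s = eps / 2"
  have s: "0 < s" "s < eps" using eps by (auto simp: s_def)
  have "summable (\<lambda>m. s ^ m *\<^sub>R a m)" using sm[of s] s by (auto simp: sums_iff)
  then have "Bseq (\<lambda>m. s ^ m *\<^sub>R a m)"
    by (intro convergent_imp_Bseq) (auto simp: convergent_def dest: summable_LIMSEQ_zero)
  then obtain B where B: "B > 0" "\<And>m. norm (s ^ m *\<^sub>R a m) \<le> B" by (auto simp: Bseq_def)
  have "norm (g t - t ^ i *\<^sub>R a i) \<le> (2 * B / s ^ Suc i) * t ^ Suc i" if t: "t \<in> {0..<s/2}" for t
  proof -
    have "(\<lambda>m. t ^ (m + Suc i) *\<^sub>R a (m + Suc i)) sums (g t - (\<Sum>m<Suc i. t ^ m *\<^sub>R a m))"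
      using sums_split_initial_segment[OF sm[of t], of "Suc i"] t s by auto
    also have "(\<Sum>m<Suc i. t ^ m *\<^sub>R a m) = t ^ i *\<^sub>R a i" using low by simp
    finally have *: "g t - t ^ i *\<^sub>R a i = (\<Sum>m. t ^ (m + Suc i) *\<^sub>R a (m + Suc i))"
      by (simp add: sums_iff)
    have bd: "norm (t ^ (m + Suc i) *\<^sub>R a (m + Suc i)) \<le> B * (t / s) ^ Suc i * (1/2) ^ m" for m
    proof -
      have "norm (t ^ (m + Suc i) *\<^sub>R a (m + Suc i)) =
          (t / s) ^ (m + Suc i) * norm (s ^ (m + Suc i) *\<^sub>R a (m + Suc i))"
        using t s by (simp add: power_divide)
      also have "\<dots> \<le> (t / s) ^ (m + Suc i) * B"
        using B(2)[of "m + Suc i"] t s by (intro mult_left_mono) simp_all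
      also have "\<dots> = B * (t / s) ^ Suc i * (t / s) ^ m" by (simp add: power_add)
      also have "\<dots> \<le> B * (t / s) ^ Suc i * (1/2) ^ m"
        using t s B by (intro mult_left_mono power_mono) (auto simp: field_simps)
      finally show ?thesis .
    qed
    have "norm (g t - t ^ i *\<^sub>R a i) \<le> (\<Sum>m. B * (t / s) ^ Suc i * (1/2) ^ m)"
      unfolding * by (intro norm_suminf_le bd summable_mult summable_geometric) auto
    also have "\<dots> = B * (t / s) ^ Suc i * 2"
      by (subst suminf_mult) (auto simp: suminf_geometric summable_geometric)
    finally show ?thesis using s by (simp add: power_divide field_simps)
  qed
  then show ?thesis using s by (intro exI[of _ "2 * B / s ^ Suc i"] exI[of _ "s/2"]) auto
qed

text \<open>Only t >= 0 counts, as in \<open>has_ps_at0\<close>: splitting and distance may behave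
  like an odd power of the absolute value of t.\<close>

definition bigO0 :: "(real \<Rightarrow> 'a::real_normed_vector) \<Rightarrow> nat \<Rightarrow> bool" where
  "bigO0 g m \<longleftrightarrow> (\<exists>C e. 0 < e \<and> (\<forall>t\<in>{0..<e}. norm (g t) \<le> C * t ^ m))"

text \<open>If the first nonzero coefficient had index j < m, its term, of exact size t ^ j, would
  be bounded by the remainder plus g, both at most a constant times t ^ Suc j.\<close>

lemma has_ps_at0_coeffs_zero_iff:
  fixes g :: "real \<Rightarrow> 'a::banach"
  assumes g: "has_ps_at0 g a"
  shows "(\<forall>j<m. a j = 0) \<longleftrightarrow> bigO0 g m"
proof
  assume "\<forall>j<m. a j = 0"
  from has_ps_at0_remainder[OF g this] obtain C e where e: "0 < e"
    "\<And>t. t \<in> {0..<e} \<Longrightarrow> norm (g t - t ^ m *\<^sub>R a m) \<le> C * t ^ Suc m" by blast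
  have "norm (g t) \<le> (\<bar>C\<bar> + norm (a m)) * t ^ m" if t: "t \<in> {0..<min e 1}" for t
  proof -
    have "norm (g t) \<le> norm (g t - t ^ m *\<^sub>R a m) + norm (t ^ m *\<^sub>R a m)"
      by (metis diff_add_cancel norm_triangle_ineq)
    also have "\<dots> \<le> C * t ^ Suc m + t ^ m * norm (a m)" using e(2)[of t] t by auto
    also have "C * t ^ Suc m \<le> \<bar>C\<bar> * t ^ m"
    proof -
      have "C * t \<le> \<bar>C\<bar> * 1" using t by (intro mult_mono) auto
      then have "(C * t) * t ^ m \<le> (\<bar>C\<bar> * 1) * t ^ m" using t by (intro mult_right_mono) auto
      then show ?thesis by simp
    qed
    finally show ?thesis by (simp add: algebra_simps)
  qed
  then show "bigO0 g m" unfolding bigO0_def using e by (metis min_less_iff_conj zero_less_one)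
next
  assume "bigO0 g m"
  then obtain C e where e: "0 < e" "\<And>t. t \<in> {0..<e} \<Longrightarrow> norm (g t) \<le> C * t ^ m"
    unfolding bigO0_def by blast
  show "\<forall>j<m. a j = 0"
  proof (rule ccontr)
    assume "\<not> ?thesis"
    then obtain j where j: "j < m" "a j \<noteq> 0" "\<And>l. l < j \<Longrightarrow> a l = 0"
      using exists_least_iff[of "\<lambda>j. j < m \<and> a j \<noteq> 0"] by (metis less_trans)
    obtain C' e' where e': "0 < e'"
      "\<And>t. t \<in> {0..<e'} \<Longrightarrow> norm (g t - t ^ j *\<^sub>R a j) \<le> C' * t ^ Suc j"
      using has_ps_at0_remainder[OF g, of j] j by blast
    define D where "D = \<bar>C\<bar> + \<bar>C'\<bar> + 1"
    \<comment> \<open>Small enough that t * D is at most half of \<open>norm (a j)\<close>, which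
      the chain below turns into a contradiction; t <= 1 allows passing from exponent m to Suc
      j.\<close>
    define t where "t = min (min (e/2) (e'/2)) (min 1 (norm (a j) / (2 * D)))"
    have D: "D > 0" by (simp add: D_def)
    have t: "0 < t" "t < e" "t < e'" "t \<le> 1" "t \<le> norm (a j) / (2 * D)"
      using e e' j D by (auto simp: t_def)
    have "t ^ j * norm (a j) = norm (t ^ j *\<^sub>R a j)" using t by simp
    also have "\<dots> \<le> norm (g t - t ^ j *\<^sub>R a j) + norm (g t)"
      by (metis norm_minus_commute norm_triangle_sub add.commute)
    also have "\<dots> \<le> C' * t ^ Suc j + C * t ^ m" using e e' t by (intro add_mono) auto
    also have "\<dots> \<le> \<bar>C'\<bar> * t ^ Suc j + \<bar>C\<bar> * t ^ Suc j"
      using t j by (intro add_mono mult_mono power_decreasing) auto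
    also have "\<dots> < D * t ^ Suc j" using t by (simp add: D_def algebra_simps)
    also have "\<dots> = t ^ j * (t * D)" by simp
    also have "t * D \<le> norm (a j) / 2" using t(5) D by (simp add: field_simps)
    finally have "t ^ j * norm (a j) < t ^ j * (norm (a j) / 2)" using t by (simp add: mult_left_mono)
    then show False using t j by (simp add: mult_less_cancel_left)
  qed
qed

text \<open>The order is thus determined by growth alone, which makes uniqueness of the coefficients
  chosen by SOME irrelevant.\<close>

lemma le_ord0_iff_bigO0:
  fixes g :: "real \<Rightarrow> 'a::banach"
  assumes "has_ps_at0 g a"
  shows "enat m \<le> ord0 g \<longleftrightarrow> bigO0 g m"
proof -
  define b where "b = (SOME a. has_ps_at0 g a)"
  have b: "has_ps_at0 g b" using assms unfolding b_def by (rule someI[where P = "has_ps_at0 g"])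
  have "enat m \<le> ord0 g \<longleftrightarrow> (\<forall>j<m. b j = 0)"
  proof (cases "\<forall>m. b m = 0")
    case True
    then show ?thesis by (simp add: ord0_def b_def[symmetric])
  next
    case False
    then have "ord0 g = enat (LEAST m. b m \<noteq> 0)" by (simp add: ord0_def b_def[symmetric] Let_def)
    moreover have "m \<le> (LEAST m. b m \<noteq> 0) \<longleftrightarrow> (\<forall>j<m. b j = 0)"
    proof -
      have "b (LEAST m. b m \<noteq> 0) \<noteq> 0" using False by (metis (mono_tags, lifting) LeastI)
      then show ?thesis by (meson not_le not_less_Least order_less_le_trans)
    qed
    ultimately show ?thesis by simp
  qed
  then show ?thesis using has_ps_at0_coeffs_zero_iff[OF b] by simp
qed

text \<open>Growth conditions exist for finite exponents only; comparing finite lower bounds settles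
  equality of possibly infinite orders as well.\<close>

lemma enat_eq_iff_le: "(x::enat) = y \<longleftrightarrow> (\<forall>m. enat m \<le> x \<longleftrightarrow> enat m \<le> y)"
proof
  assume *: "\<forall>m. enat m \<le> x \<longleftrightarrow> enat m \<le> y"
  show "x = y"
  proof (cases x; cases y)
    fix a b assume "x = enat a" "y = enat b"
    then show ?thesis using * by (metis antisym enat_ord_simps(1) order_refl)
  next
    fix a assume "x = enat a" "y = \<infinity>"
    then show ?thesis using * by (metis Suc_n_not_le_n enat_ord_code(3) enat_ord_simps(1))
  next
    fix a assume "y = enat a" "x = \<infinity>"
    then show ?thesis using * by (metis Suc_n_not_le_n enat_ord_code(3) enat_ord_simps(1))
  qed auto
qed auto

lemma bigO0_mono:
  assumes "bigO0 g m" and "0 < e" and "\<And>t. t \<in> {0..<e} \<Longrightarrow> norm (f t) \<le> c * norm (g t)" and "0 \<le> c"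
  shows "bigO0 f m"
proof -
  obtain C e' where e': "0 < e'" "\<And>t. t \<in> {0..<e'} \<Longrightarrow> norm (g t) \<le> C * t ^ m"
    using assms(1) unfolding bigO0_def by blast
  have "norm (f t) \<le> (c * C) * t ^ m" if "t \<in> {0..<min e e'}" for t
    using assms(3)[of t] mult_left_mono[OF e'(2)[of t] assms(4)] that by auto
  then show ?thesis unfolding bigO0_def using assms(2) e'(1) by (metis min_less_iff_conj)
qed

lemma bigO0_sum:
  assumes "finite A" and "\<And>i. i \<in> A \<Longrightarrow> bigO0 (f i) m"
  shows "bigO0 (\<lambda>t. \<Sum>i\<in>A. norm (f i t)) m"
  using assms
proof (induction A rule: finite_induct)
  case empty
  then show ?case unfolding bigO0_def by (intro exI[of _ 0] exI[of _ 1]) auto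
next
  case (insert i A)
  obtain C e where e: "0 < e" "\<And>t. t \<in> {0..<e} \<Longrightarrow> norm (f i t) \<le> C * t ^ m"
    using insert.prems[of i] unfolding bigO0_def by blast
  obtain C' e' where e': "0 < e'" "\<And>t. t \<in> {0..<e'} \<Longrightarrow> norm (\<Sum>i\<in>A. norm (f i t)) \<le> C' * t ^ m"
    using insert.IH insert.prems unfolding bigO0_def by blast
  have "norm (\<Sum>i\<in>insert i A. norm (f i t)) \<le> (C + C') * t ^ m" if "t \<in> {0..<min e e'}" for t
  proof -
    have "norm (\<Sum>i\<in>insert i A. norm (f i t)) \<le> norm (f i t) + norm (\<Sum>i\<in>A. norm (f i t))"
      using insert.hyps norm_triangle_ineq[of "norm (f i t)" "\<Sum>i\<in>A. norm (f i t)"] by simp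
    also have "\<dots> \<le> C * t ^ m + C' * t ^ m" using e(2)[of t] e'(2)[of t] that by (intro add_mono) auto
    finally show ?thesis by (simp add: algebra_simps)
  qed
  then show ?case unfolding bigO0_def using e(1) e'(1) by (metis min_less_iff_conj)
qed

subsection \<open>Functions of a real variable with a holomorphic extension\<close>

text \<open>Two-sided in t, in contrast to \<open>has_ps_at0\<close>: the values to the left of 0
  are what excludes zeros of odd order when a root is taken.\<close>

definition hol_at0 :: "(real \<Rightarrow> complex) \<Rightarrow> bool" where
  "hol_at0 g \<longleftrightarrow> (\<exists>r F. 0 < r \<and> F holomorphic_on ball 0 r \<and> (\<forall>t. \<bar>t\<bar> < r \<longrightarrow> g t = F (of_real t)))"

lemma hol_at0_const [simp, intro]: "hol_at0 (\<lambda>t. c)"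
  unfolding hol_at0_def by (intro exI[of _ 1] exI[of _ "\<lambda>z. c"]) auto

lemma hol_at0_cong:
  assumes "hol_at0 f" "0 < e" "\<And>t. \<bar>t\<bar> < e \<Longrightarrow> g t = f t"
  shows "hol_at0 g"
proof -
  obtain r F where "0 < r" "F holomorphic_on ball 0 r" "\<And>t. \<bar>t\<bar> < r \<Longrightarrow> f t = F (of_real t)"
    using assms(1) unfolding hol_at0_def by blast
  then show ?thesis unfolding hol_at0_def using assms(2,3)
    by (intro exI[of _ "min e r"] exI[of _ F]) (auto intro: holomorphic_on_subset)
qed

lemma hol_at0_binop:
  assumes "hol_at0 f" "hol_at0 g"
    and op: "\<And>F G S. F holomorphic_on S \<Longrightarrow> G holomorphic_on S \<Longrightarrow> (\<lambda>z. h (F z) (G z)) holomorphic_on S"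
  shows "hol_at0 (\<lambda>t. h (f t) (g t))"
proof -
  obtain r F where r: "0 < r" "F holomorphic_on ball 0 r" "\<And>t. \<bar>t\<bar> < r \<Longrightarrow> f t = F (of_real t)"
    using assms(1) unfolding hol_at0_def by blast
  obtain s G where s: "0 < s" "G holomorphic_on ball 0 s" "\<And>t. \<bar>t\<bar> < s \<Longrightarrow> g t = G (of_real t)"
    using assms(2) unfolding hol_at0_def by blast
  show ?thesis unfolding hol_at0_def
    by (intro exI[of _ "min r s"] exI[of _ "\<lambda>z. h (F z) (G z)"] conjI op)
      (use r s in \<open>auto intro: holomorphic_on_subset\<close>)
qed

lemma hol_at0_add: "hol_at0 f \<Longrightarrow> hol_at0 g \<Longrightarrow> hol_at0 (\<lambda>t. f t + g t)"
  by (rule hol_at0_binop) (auto intro: holomorphic_intros)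

lemma hol_at0_diff: "hol_at0 f \<Longrightarrow> hol_at0 g \<Longrightarrow> hol_at0 (\<lambda>t. f t - g t)"
  by (rule hol_at0_binop) (auto intro: holomorphic_intros)

lemma hol_at0_mult: "hol_at0 f \<Longrightarrow> hol_at0 g \<Longrightarrow> hol_at0 (\<lambda>t. f t * g t)"
  by (rule hol_at0_binop) (auto intro: holomorphic_intros)

lemma hol_at0_sum: "(\<And>i. i \<in> A \<Longrightarrow> hol_at0 (f i)) \<Longrightarrow> hol_at0 (\<lambda>t. \<Sum>i\<in>A. f i t)"
  by (induction A rule: infinite_finite_induct) (auto intro: hol_at0_add)

lemma hol_at0_imp_isCont:
  assumes "hol_at0 f"
  shows "isCont f 0"
proof -
  obtain r F where r: "0 < r" "F holomorphic_on ball 0 r" "\<And>t. \<bar>t\<bar> < r \<Longrightarrow> f t = F (of_real t)"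
    using assms unfolding hol_at0_def by blast
  have "isCont F (of_real 0)"
    using holomorphic_on_imp_continuous_on[OF r(2)] r(1) by (auto simp: continuous_on_eq_continuous_at)
  then have "isCont (\<lambda>t. F (of_real t)) 0"
    by (intro isCont_o2[where f = of_real and g = F]) auto
  moreover have "\<forall>\<^sub>F t in nhds 0. f t = F (of_real t)"
    unfolding eventually_nhds_metric using r by (intro exI[of _ r]) (auto simp: dist_real_def)
  ultimately show ?thesis by (subst isCont_cong) auto
qed

text \<open>Agreement is asked for t >= 0 only, because a square root of even order 2q with q odd
  agrees with its holomorphic candidate z ^ q times a nonvanishing factor on that side
  alone.\<close>

lemma has_ps_at0_holomorphic:
  assumes r: "0 < r" and F: "F holomorphic_on ball 0 r" and g: "\<And>t. t \<in> {0..<r} \<Longrightarrow> g t = F (of_real t)"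
  shows "\<exists>a. has_ps_at0 g a"
proof -
  have "(\<lambda>m. t ^ m *\<^sub>R ((deriv ^^ m) F 0 / fact m)) sums g t" if "t \<in> {0..<r}" for t
    using holomorphic_power_series[OF F, of "of_real t"] that g[of t]
    by (simp add: scaleR_conv_of_real mult.commute)
  then have "has_ps_at0 g (\<lambda>m. (deriv ^^ m) F 0 / fact m)" unfolding has_ps_at0_def using r by auto
  show ?thesis by (rule exI) fact
qed

lemma has_ps_at0_Re:
  assumes "has_ps_at0 (\<lambda>t. complex_of_real (g t)) a"
  shows "has_ps_at0 g (\<lambda>m. Re (a m))"
proof -
  obtain eps where "eps > 0" "\<And>t. t \<in> {0..<eps} \<Longrightarrow> (\<lambda>m. t ^ m *\<^sub>R a m) sums complex_of_real (g t)"
    using assms unfolding has_ps_at0_def by blast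
  then show ?thesis unfolding has_ps_at0_def
    by (intro exI[of _ eps]) (fastforce dest!: sums_Re)
qed

lemma has_ps_at0_cong:
  assumes "has_ps_at0 f a" "0 < e" "\<And>t. t \<in> {0..<e} \<Longrightarrow> g t = f t"
  shows "has_ps_at0 g a"
proof -
  obtain eps where "eps > 0" "\<And>t. t \<in> {0..<eps} \<Longrightarrow> (\<lambda>m. t ^ m *\<^sub>R a m) sums f t"
    using assms unfolding has_ps_at0_def by blast
  then show ?thesis unfolding has_ps_at0_def using assms(2,3)
    by (intro exI[of _ "min eps e"]) auto
qed

lemma hol_at0_imp_has_ps_at0:
  assumes "hol_at0 g"
  shows "\<exists>a. has_ps_at0 g a"
proof -
  obtain r F where "0 < r" "F holomorphic_on ball 0 r" "\<forall>t. \<bar>t\<bar> < r \<longrightarrow> g t = F (of_real t)"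
    using assms unfolding hol_at0_def by blast
  then show ?thesis by (intro has_ps_at0_holomorphic[of r F]) auto
qed

lemma hol_at0_real_imp_has_ps_at0:
  assumes "hol_at0 (\<lambda>t. complex_of_real (g t))"
  shows "\<exists>a. has_ps_at0 g a"
proof -
  obtain a where "has_ps_at0 (\<lambda>t. complex_of_real (g t)) a"
    using hol_at0_imp_has_ps_at0[OF assms] by (rule exE)
  from has_ps_at0_Re[OF this] show ?thesis by (intro exI)
qed

text \<open>Nonnegativity on both sides of 0 forces the order of vanishing of g to be even, so that
  its square root has a power series to the right of 0.\<close>

lemma has_ps_at0_sqrt:
  assumes hol: "hol_at0 (\<lambda>t. complex_of_real (g t))"
    and pos: "0 < e" "\<And>t. \<bar>t\<bar> < e \<Longrightarrow> 0 \<le> g t"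
  shows "\<exists>a. has_ps_at0 (\<lambda>t. sqrt (g t)) a"
proof -
  obtain r0 F where r0: "0 < r0" "F holomorphic_on ball 0 r0" "\<And>t. \<bar>t\<bar> < r0 \<Longrightarrow> of_real (g t) = F (of_real t)"
    using hol unfolding hol_at0_def by blast
  \<comment> \<open>p is the order of the zero of F at 0, with p = 0 allowed; what is left after the
    factorisation is a cofactor h with h 0 nonzero.\<close>
  have main: "\<exists>a. has_ps_at0 (\<lambda>t. sqrt (g t)) a"
    if h: "0 < r" "r \<le> r0" "h holomorphic_on ball 0 r" "\<And>w. w \<in> ball 0 r \<Longrightarrow> F w = w ^ p * h w"
      "h 0 \<noteq> 0" for h r p
  proof -
    define s where "s = min r e"
    have s: "0 < s" "s \<le> r" "s \<le> e" using h pos by (auto simp: s_def)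
    have hval: "h (of_real t) = of_real (g t / t ^ p)" if "\<bar>t\<bar> < s" "t \<noteq> 0" for t
      using h(4)[of "of_real t"] r0(3)[of t] that s h(2) by (auto simp: field_simps)
    have hc: "isCont h 0"
      using holomorphic_on_imp_continuous_on[OF h(3)] h(1) by (auto simp: continuous_on_eq_continuous_at)
    have lim: "((\<lambda>t. h (of_real t)) \<longlongrightarrow> h 0) (at 0 within A)" for A :: "real set"
    proof -
      have "isCont (\<lambda>t. h (of_real t)) 0" by (rule isCont_o2[where f = of_real and g = h]) (use hc in auto)
      then show ?thesis
        by (metis continuous_at_imp_continuous_at_within continuous_within of_real_0)
    qed
    have evr: "\<forall>\<^sub>F t in at_right 0. t < s \<and> 0 < (t::real)"
      using s(1) by (auto simp: eventually_at_right_field)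
    have evl: "\<forall>\<^sub>F t in at_left 0. -s < t \<and> (t::real) < 0"
      using s(1) unfolding eventually_at_left_field by (intro exI[of _ "-s"]) auto
    \<comment> \<open>h agrees with g t / t ^ p only off 0, so its sign at 0 is obtained as a limit
      from the right.\<close>
    have h0: "Im (h 0) = 0" "0 \<le> Re (h 0)"
    proof -
      have 1: "\<forall>\<^sub>F t in at_right 0. h (of_real t) \<in> {z. Im z = 0 \<and> 0 \<le> Re z}"
        using evr by eventually_elim (use hval pos s in auto)
      have "closed {z. Im z = 0 \<and> 0 \<le> Re z}"
        by (intro closed_Collect_conj closed_Collect_eq closed_Collect_le continuous_intros)
      then have "h 0 \<in> {z. Im z = 0 \<and> 0 \<le> Re z}"
        by (rule Lim_in_closed_set[OF _ 1 _ lim]) auto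
      then show "Im (h 0) = 0" "0 \<le> Re (h 0)" by auto
    qed
    have h0': "0 < Re (h 0)" using h0 h(5) by (metis complex_eq_iff less_eq_real_def zero_complex.sel)
    \<comment> \<open>For odd p the power t ^ p is negative to the left of 0, so the quotient is <=
      0 there and its limit contradicts the positive limit from the right.\<close>
    have "even p"
    proof (rule ccontr)
      assume "odd p"
      have 1: "\<forall>\<^sub>F t in at_left 0. h (of_real t) \<in> {z. Re z \<le> 0}"
        using evl
      proof eventually_elim
        case (elim t)
        then have "t ^ p < 0" using \<open>odd p\<close> by (simp add: power_less_zero_eq)
        then show ?case using hval[of t] pos(2)[of t] s elim by (auto simp: divide_nonneg_neg)
      qed
      have "h 0 \<in> {z. Re z \<le> 0}"
        by (rule Lim_in_closed_set[OF _ 1 _ lim]) (auto intro!: closed_Collect_le continuous_intros)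
      then show False using h0' by simp
    qed
    then obtain q where q: "p = 2 * q" by blast
    have "\<forall>\<^sub>F z in nhds 0. 0 < Re (h z)"
    proof -
      have "((\<lambda>z. Re (h z)) \<longlongrightarrow> Re (h 0)) (nhds 0)"
        using hc by (intro tendsto_Re) (simp add: isCont_def tendsto_at_iff_tendsto_nhds)
      then show ?thesis using h0' by (rule order_tendstoD)
    qed
    then obtain d where d: "0 < d" "\<And>z. dist z 0 < d \<Longrightarrow> 0 < Re (h z)"
      unfolding eventually_nhds_metric by blast
    define u where "u = min s d"
    have u: "0 < u" "u \<le> s" "u \<le> d" using s d by (auto simp: u_def)
    \<comment> \<open>Positive real part on the disc keeps h off the branch cut of
      \<open>csqrt\<close>; the power z ^ q carries the whole zero.\<close>
    have hol: "(\<lambda>z. z ^ q * csqrt (h z)) holomorphic_on ball 0 u"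
    proof (intro holomorphic_intros)
      show "h holomorphic_on ball 0 u" using h(3) u s by (auto intro: holomorphic_on_subset)
      show "h z \<notin> \<real>\<^sub>\<le>\<^sub>0" if "z \<in> ball 0 u" for z
        using d(2)[of z] that u by (auto simp: complex_nonpos_Reals_iff)
    qed
    have "\<exists>a. has_ps_at0 (\<lambda>t. complex_of_real (sqrt (g t))) a"
    proof (rule has_ps_at0_holomorphic[OF u(1) hol])
      fix t assume t: "t \<in> {0..<u}"
      have F: "of_real (g t) = of_real t ^ p * h (of_real t)"
        using r0(3)[of t] h(4)[of "of_real t"] t u s h(2) by auto
      show "complex_of_real (sqrt (g t)) = of_real t ^ q * csqrt (h (of_real t))"
      \<comment> \<open>The quotient g t / t ^ p says nothing at 0. There the claim depends on q:
        for q = 0 the factor t ^ q is 1, otherwise both sides vanish.\<close>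
      proof (cases "t = 0")
        case True
        show ?thesis
        proof (cases "q = 0")
          case q0: True
          have "h 0 = of_real (g 0)" using F q0 q True by simp
          then show ?thesis using of_real_sqrt[of "g 0"] pos(2)[of 0] pos(1) True q0 by simp
        next
          case False
          then have "g 0 = 0" using F q True by (simp add: power_0_left)
          then show ?thesis using True False by simp
        qed
      next
        case False
        then have "h (of_real t) = of_real (g t / t ^ p)" using hval[of t] t u s by auto
        then have "csqrt (h (of_real t)) = of_real (sqrt (g t / t ^ p))"
          using pos(2)[of t] t u s by (metis abs_of_nonneg atLeastLessThan_iff divide_nonneg_nonneg
              of_real_sqrt order_less_le_trans zero_le_power)
        also have "sqrt (g t / t ^ p) = sqrt (g t) / t ^ q"
        proof -
          have "sqrt (t ^ p) = t ^ q" using t by (simp add: q power_mult power2_eq_square power_mult_distrib)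
          then show ?thesis by (simp add: real_sqrt_divide)
        qed
        finally show ?thesis using False by simp
      qed
    qed
    then obtain a where "has_ps_at0 (\<lambda>t. complex_of_real (sqrt (g t))) a" by (rule exE)
    from has_ps_at0_Re[OF this] show ?thesis by (intro exI)
  qed
  show ?thesis
  proof (cases "F 0 = 0")
    case False
    then show ?thesis using main[of r0 F 0] r0 by auto
  next
    case F0: True
    show ?thesis
    \<comment> \<open>The factorisation at a zero needs a nonconstant F; a constant F with F 0 = 0
      gives the zero series, that is, infinite order.\<close>
    proof (cases "F constant_on ball 0 r0")
      case True
      then have "F z = 0" if "z \<in> ball 0 r0" for z using F0 r0(1) that unfolding constant_on_def
        by (metis centre_in_ball)
      then have "\<And>t. t \<in> {0..<r0} \<Longrightarrow> sqrt (g t) = 0" using r0(3) by force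
      then have "has_ps_at0 (\<lambda>t. sqrt (g t)) (\<lambda>m. 0)" unfolding has_ps_at0_def using r0(1) by (intro exI[of _ r0]) auto
      then show ?thesis by blast
    next
      case False
      obtain h r n where h: "0 < r" "ball 0 r \<subseteq> ball (0::complex) r0" "h holomorphic_on ball 0 r"
        "\<And>w. w \<in> ball 0 r \<Longrightarrow> F w = (w - 0) ^ n * h w" "\<And>w. w \<in> ball 0 r \<Longrightarrow> h w \<noteq> 0"
      proof (rule holomorphic_factor_zero_nonconstant[OF r0(2) open_ball connected_ball _ F0 False])
        show "0 \<in> ball (0::complex) r0" using r0(1) by simp
      qed (rule that)
      have "r \<le> r0" using h(1,2) by (simp add: ball_subset_ball_iff)
      moreover have "h 0 \<noteq> 0" using h(1,5) by simp
      moreover have "\<And>w. w \<in> ball 0 r \<Longrightarrow> F w = w ^ n * h w" using h(4) by simp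
      ultimately show ?thesis using main[OF h(1) _ h(3)] by blast
    qed
  qed
qed

text \<open>A power series converging on a real interval around its centre converges on the complex
  disc of the same radius.\<close>

lemma hol_at0_inner_if_real_analytic:
  assumes f: "real_analytic_on1 I f" and "0 \<in> I"
  shows "hol_at0 (\<lambda>t. complex_of_real (f t \<bullet> b))"
proof -
  obtain a r where r: "r > 0" "\<And>t. \<bar>t\<bar> < r \<Longrightarrow> (\<lambda>m. t ^ m *\<^sub>R a m) sums f t"
    using f \<open>0 \<in> I\<close> unfolding real_analytic_on1_def by (metis diff_zero)
  have 1: "(\<lambda>m. complex_of_real (a m \<bullet> b) * of_real t ^ m) sums of_real (f t \<bullet> b)" if "\<bar>t\<bar> < r" for t
  proof -
    have "(\<lambda>m. (t ^ m *\<^sub>R a m) \<bullet> b) sums (f t \<bullet> b)"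
      using r(2)[OF that] by (rule bounded_linear.sums[OF bounded_linear_inner_left])
    then have "(\<lambda>m. complex_of_real ((t ^ m *\<^sub>R a m) \<bullet> b)) sums of_real (f t \<bullet> b)"
      by (rule sums_of_real)
    then show ?thesis by (simp add: mult.commute)
  qed
  define F where "F = (\<lambda>z. \<Sum>m. complex_of_real (a m \<bullet> b) * z ^ m)"
  have sm: "(\<lambda>m. complex_of_real (a m \<bullet> b) * (z - 0) ^ m) sums F z" if z: "z \<in> ball 0 r" for z
  proof -
    \<comment> \<open>A real point strictly between \<open>cmod z\<close> and r; convergence there
      gives convergence at z.\<close>
    define t where "t = (cmod z + r) / 2"
    have "cmod z < t" "t < r" using z by (auto simp: t_def)
    moreover have "0 < t" using \<open>cmod z < t\<close> norm_ge_zero[of z] by linarith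
    ultimately have "\<bar>t\<bar> < r" "cmod z < cmod (of_real t)" by auto
    then have "summable (\<lambda>m. complex_of_real (a m \<bullet> b) * z ^ m)"
      by (intro powser_inside[OF sums_summable[OF 1, of t]])
    then show ?thesis unfolding F_def by (simp add: summable_sums)
  qed
  have "F holomorphic_on ball 0 r" by (rule power_series_holomorphic[OF sm])
  moreover have "of_real (f t \<bullet> b) = F (of_real t)" if "\<bar>t\<bar> < r" for t
    using 1[OF that] by (simp add: F_def sums_iff)
  ultimately show ?thesis unfolding hol_at0_def using r(1) by blast
qed

text \<open>Absolute convergence of the multivariate series at the single real point x + s D dominates
  the complexified series along the curve; coordinates in which D vanishes must not move in L.\<close>

lemma hol_at0_comp_real_analytic:
  fixes f :: "'a::euclidean_space \<Rightarrow> 'b::euclidean_space" and \<gamma> :: "real \<Rightarrow> 'a"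
  assumes f: "real_analytic_on_in L V f" and x: "\<gamma> 0 \<in> V"
    and D: "\<And>s. \<gamma> 0 + s *\<^sub>R D \<in> L"
    and D0: "\<And>b y. b \<in> Basis \<Longrightarrow> D \<bullet> b = 0 \<Longrightarrow> y \<in> L \<Longrightarrow> (y - \<gamma> 0) \<bullet> b = 0"
    and hol: "\<And>b. b \<in> Basis \<Longrightarrow> hol_at0 (\<lambda>t. complex_of_real (\<gamma> t \<bullet> b))"
    and L: "0 < e" "\<And>t. \<bar>t\<bar> < e \<Longrightarrow> \<gamma> t \<in> L"
  shows "hol_at0 (\<lambda>t. complex_of_real (f (\<gamma> t) \<bullet> v))"
proof -
  define I where "I = {\<alpha> :: 'a \<Rightarrow> nat. \<forall>b. b \<notin> Basis \<longrightarrow> \<alpha> b = 0}"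
  obtain c r where r: "r > 0" and sm: "\<And>y. y \<in> ball (\<gamma> 0) r \<Longrightarrow> y \<in> L \<Longrightarrow>
        ((\<lambda>\<alpha>. (\<Prod>b\<in>Basis. ((y - \<gamma> 0) \<bullet> b) ^ \<alpha> b) *\<^sub>R c \<alpha>) has_sum f y) I"
    using f x unfolding real_analytic_on_in_def I_def by blast
  \<comment> \<open>Keeps the point \<open>\<gamma> 0 + s *\<^sub>R D\<close> within r of
    \<open>\<gamma> 0\<close>; the added 1 avoids a division by zero.\<close>
  define s where "s = r / (2 * (norm D + 1))"
  have s: "0 < s" using r by (simp add: s_def add_nonneg_pos)
  have "r * norm D < r * (2 * (norm D + 1))"
    using r norm_ge_zero[of D] by (intro mult_strict_left_mono) (simp_all add: add_nonneg_pos)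
  moreover have "0 < 2 * (norm D + 1)" using norm_ge_zero[of D] by (simp add: add_nonneg_pos)
  ultimately have "r * norm D / (2 * (norm D + 1)) < r" by (simp only: pos_divide_less_eq)
  then have "s * norm D < r" by (simp add: s_def)
  then have "\<gamma> 0 + s *\<^sub>R D \<in> ball (\<gamma> 0) r" using s by (simp add: dist_norm)
  from sm[OF this D] have "((\<lambda>\<alpha>. (\<Prod>b\<in>Basis. (s * (D \<bullet> b)) ^ \<alpha> b) *\<^sub>R c \<alpha>) has_sum f (\<gamma> 0 + s *\<^sub>R D)) I"
    by simp
  from has_sum_imp_summable[OF has_sum_bounded_linear[OF bounded_linear_inner_left this, of v]]
  have "(\<lambda>\<alpha>. (\<Prod>b\<in>Basis. (s * (D \<bullet> b)) ^ \<alpha> b) * (c \<alpha> \<bullet> v)) summable_on I"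
    by (simp only: o_def inner_scaleR_left)
  \<comment> \<open>For real families unconditional summability is already absolute, which supplies
    the majorant for the M-test.\<close>
  then have sumI: "(\<lambda>\<alpha>. norm ((\<Prod>b\<in>Basis. (s * (D \<bullet> b)) ^ \<alpha> b) * (c \<alpha> \<bullet> v))) summable_on I"
    by (subst (asm) summable_on_iff_abs_summable_on_real)
  \<comment> \<open>Each coordinate of the curve gets an extension bounded by the corresponding
    coordinate of s D. Where D vanishes the extension is 0; elsewhere it vanishes at 0 and is small
    nearby.\<close>
  have "\<exists>h \<rho>. 0 < \<rho> \<and> h holomorphic_on ball 0 \<rho> \<and> (\<forall>z\<in>ball 0 \<rho>. cmod (h z) \<le> \<bar>s * (D \<bullet> b)\<bar>) \<and>
      (\<forall>t. \<bar>t\<bar> < \<rho> \<longrightarrow> of_real ((\<gamma> t - \<gamma> 0) \<bullet> b) = h (of_real t))" if b: "b \<in> Basis" for b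
  proof (cases "D \<bullet> b = 0")
    case True
    then show ?thesis using D0[OF b True L(2)] L(1)
      by (intro exI[of _ "\<lambda>z. 0"] exI[of _ e]) auto
  next
    case False
    have "hol_at0 (\<lambda>t. complex_of_real ((\<gamma> t - \<gamma> 0) \<bullet> b))"
      using hol_at0_diff[OF hol[OF b] hol_at0_const[of "of_real (\<gamma> 0 \<bullet> b)"]] by (simp add: inner_diff_left)
    then obtain \<rho> h where h: "0 < \<rho>" "h holomorphic_on ball 0 \<rho>"
       "\<And>t. \<bar>t\<bar> < \<rho> \<Longrightarrow> of_real ((\<gamma> t - \<gamma> 0) \<bullet> b) = h (of_real t)"
      unfolding hol_at0_def by blast
    have "isCont h 0"
      using holomorphic_on_imp_continuous_on[OF h(2)] h(1) by (auto simp: continuous_on_eq_continuous_at)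
    moreover have "h 0 = 0" using h(3)[of 0] h(1) by simp
    moreover have "0 < \<bar>s * (D \<bullet> b)\<bar>" using False s by simp
    ultimately obtain d where "d > 0" "\<And>z. dist z 0 < d \<Longrightarrow> dist (h z) 0 < \<bar>s * (D \<bullet> b)\<bar>"
      unfolding continuous_at_eps_delta by metis
    then show ?thesis using h
      by (intro exI[of _ h] exI[of _ "min d \<rho>"]) (auto intro: holomorphic_on_subset less_imp_le)
  qed
  then have "\<forall>b. \<exists>h \<rho>. b \<in> Basis \<longrightarrow> 0 < \<rho> \<and> h holomorphic_on ball 0 \<rho> \<and> (\<forall>z\<in>ball 0 \<rho>. cmod (h z) \<le> \<bar>s * (D \<bullet> b)\<bar>) \<and>
      (\<forall>t. \<bar>t\<bar> < \<rho> \<longrightarrow> of_real ((\<gamma> t - \<gamma> 0) \<bullet> b) = h (of_real t))" by blast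
  then obtain h \<rho> where h: "\<And>b. b \<in> Basis \<Longrightarrow> 0 < \<rho> b" "\<And>b. b \<in> Basis \<Longrightarrow> h b holomorphic_on ball 0 (\<rho> b)"
    "\<And>b z. b \<in> Basis \<Longrightarrow> z \<in> ball 0 (\<rho> b) \<Longrightarrow> cmod (h b z) \<le> \<bar>s * (D \<bullet> b)\<bar>"
    "\<And>b t. b \<in> Basis \<Longrightarrow> \<bar>t\<bar> < \<rho> b \<Longrightarrow> of_real ((\<gamma> t - \<gamma> 0) \<bullet> b) = h b (of_real t)"
    by metis
  have "isCont (\<lambda>t. complex_of_real (\<gamma> t \<bullet> b)) 0" if "b \<in> Basis" for b
    using hol_at0_imp_isCont[OF hol[OF that]] .
  then have "isCont (\<lambda>t. Re (complex_of_real (\<gamma> t \<bullet> b))) 0" if "b \<in> Basis" for b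
    using that continuous_Re by blast
  then have "isCont \<gamma> 0"
    unfolding isCont_def by (subst tendsto_componentwise_iff) auto
  then obtain d where d: "d > 0" "\<And>t. \<bar>t\<bar> < d \<Longrightarrow> \<gamma> t \<in> ball (\<gamma> 0) r"
    unfolding continuous_at_eps_delta using r by (metis dist_commute dist_real_def diff_zero mem_ball)
  \<comment> \<open>Halving places the closed disc inside all the open ones, as the uniform limit
    theorem works on closed discs.\<close>
  define \<sigma> where "\<sigma> = Min (insert d (insert e (\<rho> ` Basis))) / 2"
  have \<sigma>0: "0 < \<sigma>" using h(1) d L by (auto simp: \<sigma>_def)
  then have \<sigma>: "0 < \<sigma>" "\<sigma> < d" "\<sigma> < e" "\<And>b. b \<in> Basis \<Longrightarrow> \<sigma> < \<rho> b"
  proof -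
    have m: "\<sigma> * 2 \<le> y" if "y \<in> insert d (insert e (\<rho> ` Basis))" for y
    proof -
      have "Min (insert d (insert e (\<rho> ` Basis))) \<le> y" by (rule Min_le[OF _ that]) simp
      then show ?thesis by (simp add: \<sigma>_def)
    qed
    show "0 < \<sigma>" "\<sigma> < d" "\<sigma> < e" using m[of d] m[of e] \<sigma>0 by auto
    show "\<sigma> < \<rho> b" if "b \<in> Basis" for b using m[of "\<rho> b"] \<sigma>0 that by auto
  qed
  define T where "T = (\<lambda>\<alpha> z. (\<Prod>b\<in>Basis. h b z ^ \<alpha> b) * of_real (c \<alpha> \<bullet> v))"
  define F where "F = (\<lambda>z. \<Sum>\<^sub>\<infinity>\<alpha>\<in>I. T \<alpha> z)"
  have bd: "norm (T \<alpha> z) \<le> norm ((\<Prod>b\<in>Basis. (s * (D \<bullet> b)) ^ \<alpha> b) * (c \<alpha> \<bullet> v))"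
    if "\<alpha> \<in> I" "z \<in> cball 0 \<sigma>" for \<alpha> z
  proof -
    have "norm (T \<alpha> z) = (\<Prod>b\<in>Basis. cmod (h b z) ^ \<alpha> b) * \<bar>c \<alpha> \<bullet> v\<bar>"
      by (simp add: T_def norm_mult prod_norm[symmetric] norm_power)
    also have "\<dots> \<le> (\<Prod>b\<in>Basis. \<bar>s * (D \<bullet> b)\<bar> ^ \<alpha> b) * \<bar>c \<alpha> \<bullet> v\<bar>"
    proof (intro mult_right_mono prod_mono conjI power_mono)
      fix b :: 'a assume "b \<in> Basis"
      then show "cmod (h b z) \<le> \<bar>s * (D \<bullet> b)\<bar>" using h(3)[of b z] \<sigma>(4)[of b] that by auto
    qed auto
    also have "\<dots> = norm ((\<Prod>b\<in>Basis. (s * (D \<bullet> b)) ^ \<alpha> b) * (c \<alpha> \<bullet> v))"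
      by (simp only: real_norm_def abs_mult abs_prod power_abs)
    finally show ?thesis .
  qed
  have ulim: "uniform_limit (cball 0 \<sigma>) (\<lambda>X z. \<Sum>\<alpha>\<in>X. T \<alpha> z) F (finite_subsets_at_top I)"
    unfolding F_def by (rule Weierstrass_m_test_general[OF bd sumI])
  have "h b holomorphic_on cball 0 \<sigma>" if "b \<in> Basis" for b
    by (rule holomorphic_on_subset[OF h(2)[OF that]]) (use \<sigma>(4)[OF that] in auto)
  then have hT: "(\<lambda>z. \<Sum>\<alpha>\<in>X. T \<alpha> z) holomorphic_on cball 0 \<sigma>" for X
    unfolding T_def by (intro holomorphic_intros)
  have "\<forall>\<^sub>F X in finite_subsets_at_top I. continuous_on (cball 0 \<sigma>) (\<lambda>z. \<Sum>\<alpha>\<in>X. T \<alpha> z) \<and>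
      (\<lambda>z. \<Sum>\<alpha>\<in>X. T \<alpha> z) holomorphic_on ball 0 \<sigma>"
    by (intro always_eventually allI conjI holomorphic_on_imp_continuous_on[OF hT]
        holomorphic_on_subset[OF hT ball_subset_cball])
  from holomorphic_uniform_limit[OF this ulim finite_subsets_at_top_neq_bot]
  have F: "F holomorphic_on ball 0 \<sigma>" by metis
  have "of_real (f (\<gamma> t) \<bullet> v) = F (of_real t)" if t: "\<bar>t\<bar> < \<sigma>" for t
  proof -
    have "((\<lambda>\<alpha>. (\<Prod>b\<in>Basis. ((\<gamma> t - \<gamma> 0) \<bullet> b) ^ \<alpha> b) *\<^sub>R c \<alpha>) has_sum f (\<gamma> t)) I"
      using t \<sigma> d(2) L(2) by (intro sm) auto
    from has_sum_bounded_linear[OF bounded_linear_inner_left this, of v]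
    have "((\<lambda>\<alpha>. (\<Prod>b\<in>Basis. ((\<gamma> t - \<gamma> 0) \<bullet> b) ^ \<alpha> b) * (c \<alpha> \<bullet> v)) has_sum (f (\<gamma> t) \<bullet> v)) I"
      by (simp only: o_def inner_scaleR_left)
    from has_sum_bounded_linear[OF bounded_linear_of_real this, unfolded o_def]
    have "((\<lambda>\<alpha>. complex_of_real ((\<Prod>b\<in>Basis. ((\<gamma> t - \<gamma> 0) \<bullet> b) ^ \<alpha> b) * (c \<alpha> \<bullet> v))) has_sum of_real (f (\<gamma> t) \<bullet> v)) I" .
    moreover have "complex_of_real ((\<Prod>b\<in>Basis. ((\<gamma> t - \<gamma> 0) \<bullet> b) ^ \<alpha> b) * (c \<alpha> \<bullet> v)) = T \<alpha> (of_real t)" for \<alpha>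
    proof -
      have "(\<Prod>b\<in>Basis. of_real ((\<gamma> t - \<gamma> 0) \<bullet> b) ^ \<alpha> b) = (\<Prod>b\<in>Basis. h b (of_real t) ^ \<alpha> b)"
      proof (intro prod.cong refl)
        fix b :: 'a assume "b \<in> Basis"
        then show "complex_of_real ((\<gamma> t - \<gamma> 0) \<bullet> b) ^ \<alpha> b = h b (of_real t) ^ \<alpha> b"
          using h(4)[of b t] \<sigma>(4)[of b] t by simp
      qed
      then show ?thesis by (simp add: T_def)
    qed
    ultimately show ?thesis by (simp add: F_def infsumI)
  qed
  then show ?thesis unfolding hol_at0_def using F \<sigma>(1) by blast
qed

subsection \<open>Unitary matrices\<close>

definition madj :: "'n::finite cmat \<Rightarrow> 'n cmat" where
  "madj M = (\<chi> i j. cnj (M $ j $ i))"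

definition unitary :: "'n::finite cmat \<Rightarrow> bool" where
  "unitary U \<longleftrightarrow> madj U ** U = mat 1"

definition dg :: "('n::finite \<Rightarrow> complex) \<Rightarrow> 'n cmat" where
  "dg m = (\<chi> i j. if i = j then m i else 0)"

lemma madj_nth [simp]: "madj M $ i $ j = cnj (M $ j $ i)"
  by (simp add: madj_def)

lemma dg_nth [simp]: "dg m $ i $ j = (if i = j then m i else 0)"
  by (simp add: dg_def)

lemma madj_madj [simp]: "madj (madj M) = M"
  by (simp add: vec_eq_iff)

lemma madj_mult: "madj (A ** B) = madj B ** madj A"
  by (simp add: vec_eq_iff matrix_matrix_mult_def mult.commute)

lemma herm_iff_madj: "herm M \<longleftrightarrow> madj M = M"
  unfolding herm_def vec_eq_iff by (auto simp: eq_commute)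

lemma unitary_mat_1: "unitary (mat 1)"
proof -
  have "madj (mat 1 :: 'n::finite cmat) = mat 1" by (auto simp: vec_eq_iff mat_def)
  then show ?thesis by (simp add: unitary_def)
qed

lemma unitary_right: "unitary U \<Longrightarrow> U ** madj U = mat 1"
  unfolding unitary_def using matrix_left_right_inverse by blast

lemma unitary_mult: "unitary U \<Longrightarrow> unitary V \<Longrightarrow> unitary (U ** V)"
  unfolding unitary_def madj_mult by (metis matrix_mul_assoc matrix_mul_lid)

lemma unitary_madj: "unitary U \<Longrightarrow> unitary (madj U)"
  using unitary_right by (simp add: unitary_def)

lemma unitary_cancel:
  assumes "unitary U"
  shows "madj U ** (U ** X) = X" "U ** (madj U ** X) = X"
    "X ** U ** madj U = X" "X ** madj U ** U = X"
  using assms unitary_right[OF assms]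
  by (simp_all add: matrix_mul_assoc unitary_def matrix_mul_assoc[symmetric, of X])

lemma herm_conj: "herm M \<Longrightarrow> herm (U ** M ** madj U)"
  by (simp add: herm_iff_madj madj_mult matrix_mul_assoc)

lemma herm_dg_of_real: "herm (dg (\<lambda>a. of_real (m a)))"
  by (auto simp: herm_def)

lemma madj_add: "madj (A + B) = madj A + madj B" and madj_diff: "madj (A - B) = madj A - madj B"
  by (simp_all add: vec_eq_iff)

lemma mtrace_mult_commute: "mtrace (A ** B) = mtrace (B ** A)"
  by (simp add: mtrace_def matrix_matrix_mult_def mult.commute) (rule sum.swap)

lemma norm_cmat_sq: "(norm (X :: 'n::finite cmat))\<^sup>2 = (\<Sum>i\<in>UNIV. \<Sum>j\<in>UNIV. (cmod (X $ i $ j))\<^sup>2)"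
  by (simp add: norm_vec_def L2_set_def sum_nonneg)

lemma norm_cmat_sq_trace: "(norm X)\<^sup>2 = Re (mtrace (madj X ** X))"
proof -
  have "mtrace (madj X ** X) = (\<Sum>j\<in>UNIV. \<Sum>i\<in>UNIV. cnj (X $ i $ j) * X $ i $ j)"
    by (simp add: mtrace_def matrix_matrix_mult_def)
  also have "\<dots> = of_real (\<Sum>j\<in>UNIV. \<Sum>i\<in>UNIV. (cmod (X $ i $ j))\<^sup>2)"
    by (simp add: complex_norm_square mult.commute del: of_real_power)
  finally show ?thesis unfolding norm_cmat_sq by (simp only: Re_complex_of_real) (rule sum.swap)
qed

lemma norm_unitary_left [simp]:
  fixes U X :: "'n::finite cmat"
  assumes "unitary U"
  shows "norm (U ** X) = norm X"
proof -
  have "(norm (U ** X))\<^sup>2 = (norm X)\<^sup>2"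
    by (simp only: norm_cmat_sq_trace madj_mult matrix_mul_assoc[symmetric] unitary_cancel(1)[OF assms])
  then show ?thesis by simp
qed

lemma norm_madj [simp]: "norm (madj X) = norm (X :: 'n::finite cmat)"
proof -
  have "(norm (madj X))\<^sup>2 = (norm X)\<^sup>2"
    by (simp only: norm_cmat_sq_trace madj_madj mtrace_mult_commute[of X])
  then show ?thesis by simp
qed

lemma norm_unitary_right [simp]: "unitary U \<Longrightarrow> norm (X ** U) = norm (X :: 'n::finite cmat)"
  using norm_unitary_left[OF unitary_madj, of U "madj X"] by (simp only: madj_mult[symmetric] norm_madj)

lemma matrix_mult_diff_ldistrib: "A ** (B - C) = A ** B - A ** (C :: 'a::comm_ring_1^'n::finite^'n)"
  and matrix_mult_diff_rdistrib: "(B - C) ** A = B ** A - (C :: 'a::comm_ring_1^'n::finite^'n) ** A"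
  by (simp_all add: vec_eq_iff matrix_matrix_mult_def left_diff_distrib right_diff_distrib sum_subtractf)

lemma norm_conj_diff:
  fixes U X Y :: "'n::finite cmat"
  assumes "unitary U"
  shows "norm (U ** X ** madj U - U ** Y ** madj U) = norm (X - Y)"
proof -
  have "norm (U ** X ** madj U - U ** Y ** madj U) = norm (U ** (X - Y) ** madj U)"
    by (simp add: matrix_mult_diff_ldistrib matrix_mult_diff_rdistrib)
  also have "\<dots> = norm (X - Y)"
    by (simp only: norm_unitary_right[OF unitary_madj[OF assms]] norm_unitary_left[OF assms])
  finally show ?thesis .
qed

lemma cmod_nth_le_norm: "cmod (X $ i $ j) \<le> norm (X :: 'n::finite cmat)"
  using order_trans[OF Finite_Cartesian_Product.norm_nth_le[of "X $ i" j] Finite_Cartesian_Product.norm_nth_le[of X i]] .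

lemma norm_dg_sq: "(norm (dg m))\<^sup>2 = (\<Sum>a\<in>UNIV. (cmod (m a))\<^sup>2)"
proof -
  have "(\<Sum>j\<in>UNIV. (cmod (dg m $ i $ j))\<^sup>2) = (\<Sum>j\<in>UNIV. if i = j then (cmod (m i))\<^sup>2 else 0)" for i
    by (intro sum.cong) auto
  then show ?thesis by (simp add: norm_cmat_sq)
qed

lemma dg_mult: "dg a ** dg b = dg (\<lambda>i. a i * b i)"
proof -
  have "(\<Sum>k\<in>UNIV. dg a $ i $ k * dg b $ k $ j) = (\<Sum>k\<in>UNIV. if i = k then (if i = j then a i * b i else 0) else 0)" for i j
    by (intro sum.cong) auto
  then show ?thesis by (simp add: vec_eq_iff matrix_matrix_mult_def)
qed

lemma mult_dg_nth: "(X ** dg m) $ i $ j = X $ i $ j * m j"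
proof -
  have "(\<Sum>k\<in>UNIV. X $ i $ k * dg m $ k $ j) = (\<Sum>k\<in>UNIV. if j = k then X $ i $ j * m j else 0)"
    by (intro sum.cong) auto
  then show ?thesis by (simp add: matrix_matrix_mult_def)
qed

lemma dg_mult_nth: "(dg m ** X) $ i $ j = m i * X $ i $ j"
proof -
  have "(\<Sum>k\<in>UNIV. dg m $ i $ k * X $ k $ j) = (\<Sum>k\<in>UNIV. if i = k then m i * X $ i $ j else 0)"
    by (intro sum.cong) auto
  then show ?thesis by (simp add: matrix_matrix_mult_def)
qed

lemma conj_dg_nth: "(U ** dg m ** madj U) $ i $ j = (\<Sum>a\<in>UNIV. m a * (U $ i $ a * cnj (U $ j $ a)))"
  by (subst matrix_matrix_mult_def) (simp add: mult_dg_nth mult_ac)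

lemma unitary_row_sum:
  assumes "unitary U"
  shows "(\<Sum>a\<in>UNIV. (cmod (U $ i $ a))\<^sup>2) = 1"
proof -
  have "(U ** madj U) $ i $ i = 1" using unitary_right[OF assms] by (simp add: mat_def)
  then have "complex_of_real (\<Sum>a\<in>UNIV. (cmod (U $ i $ a))\<^sup>2) = 1"
    by (simp add: matrix_matrix_mult_def complex_norm_square del: of_real_power)
  then show ?thesis by (simp only: of_real_eq_1_iff)
qed

lemma unitary_col_sum:
  assumes "unitary U"
  shows "(\<Sum>i\<in>UNIV. (cmod (U $ i $ a))\<^sup>2) = 1"
  using unitary_row_sum[OF unitary_madj[OF assms], of a] by simp

text \<open>For unitary U the weights in a row sum to 1, so diagonal entries are averages of the
  eigenvalues; this is the source of the eigenvalue bounds below.\<close>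

lemma Re_conj_dg_diag:
  "Re ((U ** dg (\<lambda>a. of_real (m a)) ** madj U) $ i $ i) = (\<Sum>a\<in>UNIV. m a * (cmod (U $ i $ a))\<^sup>2)"
proof -
  have "(U ** dg (\<lambda>a. of_real (m a)) ** madj U) $ i $ i = of_real (\<Sum>a\<in>UNIV. m a * (cmod (U $ i $ a))\<^sup>2)"
    by (simp add: conj_dg_nth complex_norm_square del: of_real_power)
  then show ?thesis by (simp only: Re_complex_of_real)
qed

subsection \<open>The spectral theorem\<close>

text \<open>For N = \<open>mat 1\<close> this is the Hermitian inner product, so orthonormality of
  columns and the quadratic form of N obey the same rules.\<close>

definition sesq :: "'n::finite cmat \<Rightarrow> ('n \<Rightarrow> complex) \<Rightarrow> ('n \<Rightarrow> complex) \<Rightarrow> complex" where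
  "sesq N x y = (\<Sum>i\<in>UNIV. \<Sum>j\<in>UNIV. cnj (x i) * N $ i $ j * y j)"

lemma madj_conj_nth: "(madj U ** N ** U) $ a $ b = sesq N (\<lambda>i. U $ i $ a) (\<lambda>i. U $ i $ b)"
  unfolding sesq_def matrix_matrix_mult_def
  by (simp add: sum_distrib_right) (rule sum.swap)

lemma sesq_left: "sesq N (\<lambda>i. (c * x i + c' * y i) / of_real n) z = (cnj c * sesq N x z + cnj c' * sesq N y z) / of_real n"
  by (simp add: sesq_def algebra_simps add_divide_distrib sum_distrib_left sum_divide_distrib sum.distrib)

lemma sesq_right: "sesq N z (\<lambda>i. (c * x i + c' * y i) / of_real n) = (c * sesq N z x + c' * sesq N z y) / of_real n"
  by (simp add: sesq_def algebra_simps add_divide_distrib sum_distrib_left sum_divide_distrib sum.distrib)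

text \<open>The first-order condition for a maximum at t = 0, without derivatives: with A > 0 and X
  + A > 0, the point t = Y / A makes the expression positive unless Y = 0.\<close>

lemma max_quadratic_zero:
  fixes X Y :: real
  assumes "\<And>t. X * t\<^sup>2 + Y * t \<le> 0"
  shows "Y = 0"
proof (rule ccontr)
  assume "Y \<noteq> 0"
  define A where "A = \<bar>X\<bar> + 1"
  have A: "A > 0" "X + A > 0" by (auto simp: A_def)
  have "X * (Y / A)\<^sup>2 + Y * (Y / A) = Y\<^sup>2 * (X + A) / A\<^sup>2"
    using A by (simp add: power2_eq_square field_simps)
  also have "\<dots> > 0" using A \<open>Y \<noteq> 0\<close> by simp
  finally show False using assms[of "Y / A"] by simp
qed

text \<open>A, B, C, D are the values of the form on the pairs formed by two columns, w' stands for
  the conjugate of w and N for the normalising factor. The factors 1 are kept because the identities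
  serve as rewrite rules after \<open>sesq_left\<close> and \<open>sesq_right\<close>.\<close>

lemma plane_rotation:
  fixes A B C D w w' N :: complex
  shows "(1 * ((1 * A + w * B) / N) + w' * ((1 * C + w * D) / N)) / N = (A + w * B + w' * C + (w * w') * D) / (N * N)"
    and "(- w * ((- w' * A + 1 * B) / N) + 1 * ((- w' * C + 1 * D) / N)) / N = (D - w * B - w' * C + (w * w') * A) / (N * N)"
proof -
  have "1 * ((1 * A + w * B) / N) + w' * ((1 * C + w * D) / N) = (A + w * B + w' * C + (w * w') * D) / N"
    by (simp add: add_divide_distrib distrib_left mult_ac)
  then show "(1 * ((1 * A + w * B) / N) + w' * ((1 * C + w * D) / N)) / N = (A + w * B + w' * C + (w * w') * D) / (N * N)"
    by simp
  have "- w * ((- w' * A + 1 * B) / N) + 1 * ((- w' * C + 1 * D) / N) = (- w * (- w' * A + B) + (- w' * C + D)) / N"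
    by (simp only: mult_1 times_divide_eq_right add_divide_distrib[symmetric])
  also have "- w * (- w' * A + B) + (- w' * C + D) = D - w * B - w' * C + (w * w') * A"
    by (simp add: algebra_simps)
  finally show "(- w * ((- w' * A + 1 * B) / N) + 1 * ((- w' * C + 1 * D) / N)) / N = (D - w * B - w' * C + (w * w') * A) / (N * N)"
    by simp
qed

text \<open>Diagonalisation by maximising the sum of d i times the i-th diagonal entry of U* N U, with
  distinct weights d, over the compact group of unitaries compatible with the block partition p:
  a nonzero off-diagonal entry inside a block would allow an improving plane rotation.\<close>

lemma spectral_theorem_block:
  fixes N :: "'n::finite cmat" and p :: "'n \<Rightarrow> 'c"
  assumes N: "herm N" and Np: "\<And>i j. p i \<noteq> p j \<Longrightarrow> N $ i $ j = 0"
  shows "\<exists>U m. unitary U \<and> (\<forall>i j. p i \<noteq> p j \<longrightarrow> U $ i $ j = 0) \<and>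
      N = U ** dg (\<lambda>a. complex_of_real (m a)) ** madj U"
proof -
  \<comment> \<open>With equal weights a rotation of two columns would leave their share of
    \<open>f\<close>, a partial trace, unchanged.\<close>
  obtain d0 :: "'n \<Rightarrow> nat" where d0: "inj d0"
    using finite_imp_inj_to_nat_seg[of "UNIV :: 'n set"] by auto
  define d where "d = (\<lambda>i. real (d0 i))"
  have d: "d i \<noteq> d j" if "i \<noteq> j" for i j using that d0 by (auto simp: d_def inj_def)
  define S where "S = {U :: 'n cmat. (\<forall>i j. sesq (mat 1) (\<lambda>l. U $ l $ i) (\<lambda>l. U $ l $ j) = (if i = j then 1 else 0)) \<and>
      (\<forall>i j. p i \<noteq> p j \<longrightarrow> U $ i $ j = 0)}"
  define f where "f = (\<lambda>U :: 'n cmat. \<Sum>i\<in>UNIV. d i * Re (sesq N (\<lambda>l. U $ l $ i) (\<lambda>l. U $ l $ i)))"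
  have Suni: "U \<in> S \<longleftrightarrow> unitary U \<and> (\<forall>i j. p i \<noteq> p j \<longrightarrow> U $ i $ j = 0)" for U
  proof -
    have "sesq (mat 1) (\<lambda>l. U $ l $ i) (\<lambda>l. U $ l $ j) = (madj U ** U) $ i $ j" for i j
      by (simp add: madj_conj_nth[symmetric])
    then show ?thesis unfolding S_def unitary_def by (auto simp: vec_eq_iff mat_def)
  qed
  have cont: "continuous_on UNIV (\<lambda>U :: 'n cmat. sesq M (\<lambda>l. U $ l $ i) (\<lambda>l. U $ l $ j))" for M i j
    unfolding sesq_def by (intro continuous_intros)
  have "closed S"
  proof -
    have "closed {U :: 'n cmat. p i \<noteq> p j \<longrightarrow> U $ i $ j = 0}" for i j
      by (cases "p i = p j") (auto intro!: closed_Collect_eq continuous_intros)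
    moreover have "closed {U :: 'n cmat. sesq (mat 1) (\<lambda>l. U $ l $ i) (\<lambda>l. U $ l $ j) = (if i = j then 1 else 0)}" for i j
      by (intro closed_Collect_eq cont continuous_intros)
    ultimately show ?thesis unfolding S_def by (intro closed_Collect_conj closed_Collect_all)
  qed
  moreover have "bounded S"
  proof (rule boundedI)
    fix U assume "U \<in> S"
    then have "(norm U)\<^sup>2 = Re (mtrace (mat 1 :: 'n cmat))"
      unfolding norm_cmat_sq_trace using Suni unitary_def by metis
    also have "\<dots> = real CARD('n)" by (simp add: mtrace_def mat_def)
    finally show "norm U \<le> sqrt (real CARD('n))" by (simp add: real_le_rsqrt)
  qed
  ultimately have "compact S" by (simp add: compact_eq_bounded_closed)
  moreover have "mat 1 \<in> S" 
  proof -
    have "(mat 1 :: 'n cmat) $ i $ j = 0" if "p i \<noteq> p j" for i j using that by (auto simp: mat_def)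
    then show ?thesis unfolding Suni using unitary_mat_1 by blast
  qed
  moreover have "continuous_on S f"
    unfolding f_def by (intro continuous_intros continuous_on_subset[OF cont]) auto
  ultimately obtain U where U: "U \<in> S" and max: "\<And>V. V \<in> S \<Longrightarrow> f V \<le> f U"
    using continuous_attains_sup[of S f] by blast
  define M where "M = madj U ** N ** U"
  have unU: "unitary U" and pU: "\<And>i j. p i \<noteq> p j \<Longrightarrow> U $ i $ j = 0" using U Suni by auto
  have M: "herm M" unfolding M_def using herm_conj[OF N, of "madj U"] by simp
  have sesqN: "sesq N (\<lambda>l. U $ l $ i) (\<lambda>l. U $ l $ j) = M $ i $ j" for i j
    by (simp add: M_def madj_conj_nth)
  have sesq1: "sesq (mat 1) (\<lambda>l. U $ l $ i) (\<lambda>l. U $ l $ j) = (if i = j then 1 else 0)" for i j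
    using U by (simp add: S_def)
  have "M $ a $ b = 0" if ab: "a \<noteq> b" for a b
  proof (cases "p a = p b")
    case False
    show ?thesis unfolding M_def matrix_matrix_mult_def madj_def
      by (simp, intro sum.neutral ballI)
         (metis (no_types, lifting) Np False complex_cnj_zero mult_eq_0_iff pU sum.neutral)
  next
    case True
    have Mba: "M $ b $ a = cnj (M $ a $ b)" using M unfolding herm_def by blast
    have "Im (M $ a $ a) = 0" "Im (M $ b $ b) = 0" using M unfolding herm_def by (metis complex_cnj complex_eq_iff equal_neg_zero complex.sel(2) cnj.simps(2))+
    have "2 * (d a - d b) * cmod (M $ a $ b) = 0"
    proof (rule max_quadratic_zero[where X = "(d a - d b) * (Re (M $ b $ b) - Re (M $ a $ a))"])
      fix t :: real
      \<comment> \<open>The phase that turns the off-diagonal entry into its modulus; any unit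
        number serves when that entry is 0.\<close>
      define u where "u = (if M $ a $ b = 0 then 1 else cnj (M $ a $ b) / of_real (cmod (M $ a $ b)))"
      define w where "w = of_real t * u"
      define n where "n = sqrt (1 + t\<^sup>2)"
      have n: "n > 0" "n\<^sup>2 = 1 + t\<^sup>2" by (simp_all add: n_def add_pos_nonneg)
      have cM: "M $ a $ b * cnj (M $ a $ b) = of_real (cmod (M $ a $ b)) * of_real (cmod (M $ a $ b))"
        using complex_norm_square[of "M $ a $ b"] by (simp add: power2_eq_square)
      have uu: "u * cnj u = 1"
        using cM by (simp add: u_def mult.commute)
      have uM: "u * M $ a $ b = of_real (cmod (M $ a $ b))"
        using cM by (simp add: u_def mult.commute)
      have ww: "w * cnj w = of_real (t\<^sup>2)"
      proof -
        have "w * cnj w = (of_real t * of_real t) * (u * cnj u)" by (simp add: w_def)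
        then show ?thesis unfolding uu by (simp add: power2_eq_square)
      qed
      have wM: "w * M $ a $ b = of_real (t * cmod (M $ a $ b))"
        by (simp add: w_def uM mult.assoc)
      \<comment> \<open>Columns a and b of U are rotated in their plane by parameter t; t = 0 gives
        back U, so maximality of U becomes a condition on the linear coefficient in t.\<close>
      define V where "V = (\<chi> i j. if j = a then (1 * U $ i $ a + w * U $ i $ b) / of_real n
            else if j = b then (- cnj w * U $ i $ a + 1 * U $ i $ b) / of_real n else U $ i $ j)"
      have Va: "(\<lambda>l. V $ l $ a) = (\<lambda>l. (1 * U $ l $ a + w * U $ l $ b) / of_real n)"
        by (simp add: V_def)
      have Vb: "(\<lambda>l. V $ l $ b) = (\<lambda>l. (- cnj w * U $ l $ a + 1 * U $ l $ b) / of_real n)"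
        using ab by (simp add: V_def)
      have Vj: "(\<lambda>l. V $ l $ j) = (\<lambda>l. U $ l $ j)" if "j \<noteq> a" "j \<noteq> b" for j
        using that by (simp add: V_def)
      have nn: "complex_of_real n * of_real n = 1 + w * cnj w"
        unfolding ww using n(2) by (metis of_real_1 of_real_add of_real_mult power2_eq_square)
      have nn0: "1 + w * cnj w \<noteq> 0" using nn n(1) by (metis mult_eq_0_iff of_real_eq_0_iff less_irrefl)
      have "V \<in> S"
        unfolding S_def
      proof (intro CollectI conjI allI impI)
        fix i j
        have aa: "sesq (mat 1) (\<lambda>l. V $ l $ a) (\<lambda>l. V $ l $ a) = 1"
          unfolding Va sesq_left sesq_right sesq1 complex_cnj_one plane_rotation(1) using ab nn nn0 by simp
        have bb: "sesq (mat 1) (\<lambda>l. V $ l $ b) (\<lambda>l. V $ l $ b) = 1"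
          unfolding Vb sesq_left sesq_right sesq1 complex_cnj_one complex_cnj_minus complex_cnj_cnj plane_rotation(2)
          using ab nn nn0 by simp
        have ab': "sesq (mat 1) (\<lambda>l. V $ l $ a) (\<lambda>l. V $ l $ b) = 0"
          unfolding Va Vb sesq_left sesq_right sesq1 using ab by simp
        have ba: "sesq (mat 1) (\<lambda>l. V $ l $ b) (\<lambda>l. V $ l $ a) = 0"
          unfolding Va Vb sesq_left sesq_right sesq1 using ab by simp
        have aj: "sesq (mat 1) (\<lambda>l. V $ l $ a) (\<lambda>l. V $ l $ j) = 0" if "j \<noteq> a" "j \<noteq> b" for j
          unfolding Va Vj[OF that] sesq_left sesq1 using that by simp
        have bj: "sesq (mat 1) (\<lambda>l. V $ l $ b) (\<lambda>l. V $ l $ j) = 0" if "j \<noteq> a" "j \<noteq> b" for j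
          unfolding Vb Vj[OF that] sesq_left sesq1 using that by simp
        have ja: "sesq (mat 1) (\<lambda>l. V $ l $ j) (\<lambda>l. V $ l $ a) = 0" if "j \<noteq> a" "j \<noteq> b" for j
          unfolding Va Vj[OF that] sesq_right sesq1 using that by simp
        have jb: "sesq (mat 1) (\<lambda>l. V $ l $ j) (\<lambda>l. V $ l $ b) = 0" if "j \<noteq> a" "j \<noteq> b" for j
          unfolding Vb Vj[OF that] sesq_right sesq1 using that by simp
        have jj: "sesq (mat 1) (\<lambda>l. V $ l $ i) (\<lambda>l. V $ l $ j) = (if i = j then 1 else 0)"
          if "i \<noteq> a" "i \<noteq> b" "j \<noteq> a" "j \<noteq> b"
          unfolding Vj[OF that(1,2)] Vj[OF that(3,4)] by (rule sesq1)
        show "sesq (mat 1) (\<lambda>l. V $ l $ i) (\<lambda>l. V $ l $ j) = (if i = j then 1 else 0)"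
        proof -
          consider "i = a" "j = a" | "i = a" "j = b" | "i = b" "j = a" | "i = b" "j = b"
            | "i = a" "j \<noteq> a" "j \<noteq> b" | "i = b" "j \<noteq> a" "j \<noteq> b" | "j = a" "i \<noteq> a" "i \<noteq> b" | "j = b" "i \<noteq> a" "i \<noteq> b"
            | "i \<noteq> a" "i \<noteq> b" "j \<noteq> a" "j \<noteq> b" by blast
          then show ?thesis
          proof cases
            case 1 then show ?thesis by (simp only: aa refl if_True)
          next
            case 2 then show ?thesis using ab by (simp only: ab' if_False)
          next
            case 3 then show ?thesis using ab[symmetric] by (simp only: ba if_False)
          next
            case 4 then show ?thesis by (simp only: bb refl if_True)
          next
            case 5 then show ?thesis using aj[OF 5(2,3)] 5(2)[symmetric] by (simp only: if_False)
          next
            case 6 then show ?thesis using bj[OF 6(2,3)] 6(3)[symmetric] by (simp only: if_False)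
          next
            case 7 then show ?thesis using ja[OF 7(2,3)] by (simp only: if_False)
          next
            case 8 then show ?thesis using jb[OF 8(2,3)] by (simp only: if_False)
          next
            case 9 show ?thesis by (rule jj[OF 9])
          qed
        qed
      next
        \<comment> \<open>a and b belong to the same block, so the two mixed columns have the same
          forced zeros.\<close>
        fix i j assume "p i \<noteq> p j"
        then have "U $ i $ j = 0" "j \<in> {a, b} \<Longrightarrow> U $ i $ a = 0 \<and> U $ i $ b = 0"
          using pU[of i a] pU[of i b] pU[of i j] True by auto
        then show "V $ i $ j = 0" by (cases "j = a"; cases "j = b"; simp add: V_def)
      qed
      then have "f V \<le> f U" by (rule max)
      moreover have "f V - f U = ((d a - d b) * (Re (M $ b $ b) - Re (M $ a $ a)) * t\<^sup>2 + 2 * (d a - d b) * cmod (M $ a $ b) * t) / n\<^sup>2"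
      proof -
        define g where "g = (\<lambda>W i. d i * Re (sesq N (\<lambda>l. W $ l $ i) (\<lambda>l. W $ l $ i)))"
        have split: "(\<Sum>i\<in>UNIV. g W i) = g W a + g W b + (\<Sum>i\<in>UNIV - {a, b}. g W i)" for W :: "'n cmat"
        proof -
          have "(\<Sum>i\<in>UNIV. g W i) = (\<Sum>i\<in>{a, b}. g W i) + (\<Sum>i\<in>UNIV - {a, b}. g W i)"
            by (metis sum.subset_diff add.commute finite subset_UNIV)
          then show ?thesis using ab by simp
        qed
        have "(\<Sum>i\<in>UNIV - {a, b}. g V i) = (\<Sum>i\<in>UNIV - {a, b}. g U i)"
          by (intro sum.cong refl) (simp add: g_def Vj)
        then have 1: "f V - f U = g V a + g V b - g U a - g U b"
          unfolding f_def using split[of V] split[of U] by (simp add: g_def)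
        have wM': "cnj w * M $ b $ a = of_real (t * cmod (M $ a $ b))"
          using arg_cong[OF wM, of cnj] by (simp add: Mba)
        have two: "complex_of_real (2 * t * cmod (M $ a $ b)) = of_real (t * cmod (M $ a $ b)) + of_real (t * cmod (M $ a $ b))"
          by simp
        have va: "sesq N (\<lambda>l. V $ l $ a) (\<lambda>l. V $ l $ a) =
            (M $ a $ a + of_real (2 * t * cmod (M $ a $ b)) + of_real (t\<^sup>2) * M $ b $ b) / of_real (n\<^sup>2)"
        proof -
          have "sesq N (\<lambda>l. V $ l $ a) (\<lambda>l. V $ l $ a) =
             (M $ a $ a + w * M $ a $ b + cnj w * M $ b $ a + (w * cnj w) * M $ b $ b) / of_real (n\<^sup>2)"
            unfolding Va sesq_left sesq_right sesqN complex_cnj_one plane_rotation(1) by (simp add: power2_eq_square)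
          then show ?thesis unfolding wM wM' ww two by (simp only: add.assoc diff_diff_eq)
        qed
        have vb: "sesq N (\<lambda>l. V $ l $ b) (\<lambda>l. V $ l $ b) =
            (M $ b $ b - of_real (2 * t * cmod (M $ a $ b)) + of_real (t\<^sup>2) * M $ a $ a) / of_real (n\<^sup>2)"
        proof -
          have "sesq N (\<lambda>l. V $ l $ b) (\<lambda>l. V $ l $ b) =
             (M $ b $ b - w * M $ a $ b - cnj w * M $ b $ a + (w * cnj w) * M $ a $ a) / of_real (n\<^sup>2)"
            unfolding Vb sesq_left sesq_right sesqN complex_cnj_one complex_cnj_minus complex_cnj_cnj plane_rotation(2)
            by (simp add: power2_eq_square)
          then show ?thesis unfolding wM wM' ww two by (simp only: add.assoc diff_diff_eq)
        qed
        have "g V a = d a * ((Re (M $ a $ a) + 2 * t * cmod (M $ a $ b) + t\<^sup>2 * Re (M $ b $ b)) / n\<^sup>2)"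
          unfolding g_def va by (simp only: Re_divide_of_real plus_complex.sel times_complex.sel Re_complex_of_real Im_complex_of_real) simp
        moreover have "g V b = d b * ((Re (M $ b $ b) - 2 * t * cmod (M $ a $ b) + t\<^sup>2 * Re (M $ a $ a)) / n\<^sup>2)"
          unfolding g_def vb by (simp only: Re_divide_of_real plus_complex.sel minus_complex.sel times_complex.sel Re_complex_of_real Im_complex_of_real) simp
        moreover have "g U a = d a * (((1 + t\<^sup>2) * Re (M $ a $ a)) / n\<^sup>2)" "g U b = d b * (((1 + t\<^sup>2) * Re (M $ b $ b)) / n\<^sup>2)"
          unfolding g_def sesqN n(2)[symmetric] using n(1) by simp_all
        ultimately show ?thesis unfolding 1
          by (simp add: add_divide_distrib[symmetric] diff_divide_distrib[symmetric] algebra_simps)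
      qed
      ultimately have "((d a - d b) * (Re (M $ b $ b) - Re (M $ a $ a)) * t\<^sup>2 + 2 * (d a - d b) * cmod (M $ a $ b) * t) / n\<^sup>2 \<le> 0"
        by linarith
      then show "(d a - d b) * (Re (M $ b $ b) - Re (M $ a $ a)) * t\<^sup>2 + 2 * (d a - d b) * cmod (M $ a $ b) * t \<le> 0"
        using n(1) by (simp add: divide_le_0_iff)
    qed
    then show ?thesis using d[OF ab] by simp
  qed
  moreover have "M $ a $ a = of_real (Re (M $ a $ a))" for a
    using M unfolding herm_def by (metis Reals_cnj_iff of_real_Re)
  ultimately have "M = dg (\<lambda>a. complex_of_real (Re (M $ a $ a)))"
    by (simp add: vec_eq_iff)
  moreover have "N = U ** M ** madj U"
    unfolding M_def by (simp add: matrix_mul_assoc unitary_right[OF unU] unitary_cancel[OF unU])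
  ultimately show ?thesis using unU pU by metis
qed

lemma spectral_theorem:
  assumes "herm (N :: 'n::finite cmat)"
  shows "\<exists>U m. unitary U \<and> N = U ** dg (\<lambda>a. complex_of_real (m a)) ** madj U"
  using spectral_theorem_block[OF assms, of "\<lambda>_. ()"] by auto

subsection \<open>Eigenvalues\<close>

lemma const_poly_sum: "[:sum f A:] = (\<Sum>x\<in>A. [:f x :: 'a::comm_monoid_add:])"
  by (auto simp: poly_eq_iff coeff_sum coeff_pCons split: nat.splits)

lemma mat_mult_commute:
  fixes M :: "'a::comm_ring_1^'n::finite^'n"
  shows "mat x ** M = M ** mat x"
proof -
  have "(\<Sum>k\<in>UNIV. (mat x :: 'a^'n^'n) $ i $ k * M $ k $ j) = (\<Sum>k\<in>UNIV. if i = k then x * M $ i $ j else 0)" for i j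
    by (intro sum.cong) (auto simp: mat_def)
  moreover have "(\<Sum>k\<in>UNIV. M $ i $ k * (mat x :: 'a^'n^'n) $ k $ j) = (\<Sum>k\<in>UNIV. if j = k then x * M $ i $ j else 0)" for i j
    by (intro sum.cong) (auto simp: mat_def mult.commute)
  ultimately show ?thesis by (simp add: vec_eq_iff matrix_matrix_mult_def)
qed

text \<open>The embedding \<open>cp\<close> of constant matrices into polynomial matrices is
  multiplicative, and the scalar matrix \<open>X\<close> commutes with everything, so the
  conjugation can be pulled out of the determinant.\<close>

lemma char_poly_conj_dg:
  fixes U :: "'n::finite cmat"
  assumes U: "unitary U"
  shows "char_poly (U ** dg m ** madj U) = (\<Prod>a\<in>UNIV. [:- m a, 1:])"
proof -
  define cp where "cp = (\<lambda>A :: 'n cmat. (\<chi> i j. [:A $ i $ j:]) :: complex poly^'n^'n)"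
  define X where "X = (mat [:0, 1:] :: complex poly^'n^'n)"
  have cpm: "cp (A ** B) = cp A ** cp B" for A B
    by (simp add: cp_def vec_eq_iff matrix_matrix_mult_def const_poly_sum mult.commute)
  have cp1: "cp (mat 1) = mat 1" by (simp add: cp_def vec_eq_iff mat_def one_pCons)
  have chp: "char_poly A = det (X - cp A)" for A
    unfolding char_poly_def X_def cp_def by (rule arg_cong[of _ _ det]) (simp add: vec_eq_iff mat_def)
  have "cp U ** X ** cp (madj U) = X ** (cp U ** cp (madj U))"
    by (simp only: X_def mat_mult_commute[of _ "cp U", symmetric] matrix_mul_assoc)
  also have "\<dots> = X"
    by (simp only: cpm[symmetric] unitary_right[OF U] cp1 matrix_mul_rid)
  finally have X: "cp U ** X ** cp (madj U) = X" .
  then have "X - cp (U ** dg m ** madj U) = cp U ** (X - cp (dg m)) ** cp (madj U)"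
    by (simp only: cpm matrix_mult_diff_ldistrib matrix_mult_diff_rdistrib X)
  then have "char_poly (U ** dg m ** madj U) = det (X - cp (dg m)) * (det (cp U) * det (cp (madj U)))"
    unfolding chp by (simp add: det_mul mult_ac)
  also have "det (cp U) * det (cp (madj U)) = 1"
    unfolding det_mul[symmetric] cpm[symmetric] unitary_right[OF U] cp1 by simp
  also have "det (X - cp (dg m)) = (\<Prod>a\<in>UNIV. (X - cp (dg m)) $ a $ a)"
    by (rule det_diagonal) (simp add: X_def cp_def mat_def)
  also have "\<dots> = (\<Prod>a\<in>UNIV. [:- m a, 1:])"
    by (intro prod.cong) (simp_all add: X_def cp_def mat_def)
  finally show ?thesis by simp
qed

lemma sum_singleton_mset: "finite A \<Longrightarrow> (\<Sum>x\<in>A. {#f x#}) = image_mset f (mset_set A)"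
  by (induction A rule: finite_induct) auto

lemma eigvals_conj_dg:
  fixes U :: "'n::finite cmat"
  assumes "unitary U"
  shows "eigvals (U ** dg (\<lambda>a. of_real (m a)) ** madj U) = sorted_list_of_multiset (image_mset m (mset_set UNIV))"
proof -
  have "proots (\<Prod>a\<in>UNIV. [:- complex_of_real (m a), 1:]) = (\<Sum>a\<in>(UNIV::'n set). {#complex_of_real (m a)#})"
    by (subst proots_prod) auto
  then show ?thesis
    unfolding eigvals_def char_poly_conj_dg[OF assms] by (simp add: sum_singleton_mset image_mset.compositionality o_def)
qed

lemma mset_eigvals_conj_dg:
  fixes U :: "'n::finite cmat"
  assumes "unitary U"
  shows "mset (eigvals (U ** dg (\<lambda>a. of_real (m a)) ** madj U)) = image_mset m (mset_set UNIV)"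
  by (simp add: eigvals_conj_dg[OF assms])

lemma sorted_eigvals: "sorted (eigvals H)"
  by (simp add: eigvals_def)

text \<open>Indices outside A never take one of the first k listed values, so these values, with
  multiplicity, are all provided by A; as both multisets have k elements, they agree. Avoidance also
  excludes a tie between A and its complement.\<close>

lemma mset_take_eq_if_complement_avoids:
  fixes m :: "'n::finite \<Rightarrow> real"
  assumes xs: "sorted xs" "mset xs = image_mset m (mset_set UNIV)"
    and A: "card A = k" and avoid: "\<And>b. b \<notin> A \<Longrightarrow> m b \<notin> set (take k xs)"
  shows "image_mset m (mset_set A) = mset (take k xs)"
    and "a \<in> A \<Longrightarrow> b \<notin> A \<Longrightarrow> m a < m b"
proof -
  define T where "T = set (take k xs)"
  have len: "length xs = CARD('n)" using arg_cong[OF xs(2), of size] by simp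
  have k: "k \<le> CARD('n)" unfolding A[symmetric] by (rule card_mono) auto
  have "mset (take k xs) = filter_mset (\<lambda>x. x \<in> T) (mset (take k xs))"
    by (simp add: T_def flip: mset_filter)
  also have "\<dots> \<subseteq># filter_mset (\<lambda>x. x \<in> T) (mset xs)"
    by (rule multiset_filter_mono) (metis append_take_drop_id mset_append mset_subset_eq_add_left)
  also have "\<dots> = image_mset m (mset_set {a. m a \<in> T})"
    unfolding xs(2) by (simp add: filter_mset_image_mset filter_mset_mset_set)
  also have "\<dots> \<subseteq># image_mset m (mset_set A)"
    by (intro image_mset_subseteq_mono) (use avoid in \<open>auto simp: T_def subset_imp_msubset_mset_set\<close>)
  finally have sub: "mset (take k xs) \<subseteq># image_mset m (mset_set A)" .
  have "size (mset (take k xs)) = size (image_mset m (mset_set A))" using len k A by simp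
  then show eq: "image_mset m (mset_set A) = mset (take k xs)"
    using sub mset_subset_size[of "mset (take k xs)" "image_mset m (mset_set A)"]
    by (metis less_irrefl subset_mset.le_imp_less_or_eq)
  assume ab: "a \<in> A" "b \<notin> A"
  have "m a \<in># image_mset m (mset_set A)" using ab by simp
  then have a: "m a \<in> set (take k xs)" unfolding eq by simp
  have "m b \<in># mset xs" unfolding xs(2) by simp
  then have b: "m b \<in> set (drop k xs)" using avoid[OF ab(2)]
    by (metis Un_iff append_take_drop_id set_append set_mset_mset)
  have "sorted (take k xs @ drop k xs)" using xs(1) by simp
  then have "m a \<le> m b" unfolding sorted_append using a b by blast
  moreover have "m a \<noteq> m b" using avoid[OF ab(2)] a by metis
  ultimately show "m a < m b" by simp
qed

text \<open>Passes from the sorted eigenvalue list to a diagonalisation in arbitrary order. The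
  witness is the set of indices carrying the lowest value, which the list contains exactly k
  times.\<close>

lemma Sigma_imp_eigen_split:
  fixes U :: "'n::finite cmat"
  assumes U: "unitary U" and H: "U ** dg (\<lambda>a. of_real (m a)) ** madj U \<in> Sigma k"
    and k: "1 \<le> k" "k < CARD('n)"
  shows "\<exists>A. card A = k \<and> (\<forall>a\<in>A. m a = lam (U ** dg (\<lambda>a. of_real (m a)) ** madj U) 1) \<and>
      (\<forall>b. b \<notin> A \<longrightarrow> lam (U ** dg (\<lambda>a. of_real (m a)) ** madj U) 1 < m b)"
proof -
  define G where "G = U ** dg (\<lambda>a. of_real (m a)) ** madj U"
  define xs where "xs = eigvals G"
  define c where "c = lam G 1"
  have xs: "sorted xs" "mset xs = image_mset m (mset_set UNIV)"
    unfolding xs_def G_def by (rule sorted_eigvals, rule mset_eigvals_conj_dg[OF U])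
  have len: "length xs = CARD('n)" using arg_cong[OF xs(2), of size] by simp
  have "G \<in> Sigma k" using H unfolding G_def .
  then have lamG: "\<forall>j\<in>{1..k}. lam G j = c" "lam G k < lam G (k + 1)"
    unfolding Sigma_def c_def by blast+
  have low: "xs ! i = c" if "i < k" for i
  proof -
    have "lam G (Suc i) = c" using that by (intro bspec[OF lamG(1)]) simp
    then show ?thesis by (simp add: lam_def xs_def)
  qed
  \<comment> \<open>\<open>lam\<close> counts from 1 and lists from 0: \<open>xs ! k\<close> is the
    eigenvalue number k + 1.\<close>
  have up: "c < xs ! k"
    using lamG(2) low[of "k - 1"] k unfolding lam_def xs_def by simp
  have T: "x = c" if "x \<in> set (take k xs)" for x
    using that low by (auto simp: in_set_conv_nth)
  have D: "c < x" if x: "x \<in> set (drop k xs)" for x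
  proof -
    obtain i where "i < length xs - k" "x = xs ! (k + i)" using x by (auto simp: in_set_conv_nth)
    then have "xs ! k \<le> x" using sorted_nth_mono[OF xs(1), of k "k + i"] by simp
    then show ?thesis using up by simp
  qed
  have mem: "m b = c \<or> c < m b" for b
  proof -
    have "m b \<in># mset xs" unfolding xs(2) by simp
    then have "m b \<in> set (take k xs @ drop k xs)" by simp
    then have "m b \<in> set (take k xs) \<or> m b \<in> set (drop k xs)" unfolding set_append by (rule UnE) blast+
    then show ?thesis using T[of "m b"] D[of "m b"] by blast
  qed
  have "count (mset xs) c = card {a. m a = c}"
    unfolding xs(2) by (simp add: count_image_mset' eq_commute[of c])
  moreover have "count (mset xs) c = k"
  proof -
    have "mset xs = mset (take k xs) + mset (drop k xs)" by (metis append_take_drop_id mset_append)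
    moreover have "take k xs = replicate k c"
      using low len k by (intro nth_equalityI) auto
    moreover have "count (mset (drop k xs)) c = 0" using D by (auto simp: count_eq_zero_iff)
    ultimately show ?thesis by simp
  qed
  ultimately have "card {a. m a = c} = k" by simp
  then show ?thesis using mem unfolding G_def[symmetric] c_def[symmetric]
    by (intro exI[of _ "{a. m a = c}"]) auto
qed

lemma Sigma_if_eigen_split:
  fixes U :: "'n::finite cmat"
  assumes U: "unitary U" and A: "card A = k" "\<And>a. a \<in> A \<Longrightarrow> m a = c" "\<And>b. b \<notin> A \<Longrightarrow> c < m b"
    and k: "1 \<le> k" "k < CARD('n)"
  shows "U ** dg (\<lambda>a. of_real (m a)) ** madj U \<in> Sigma k"
proof -
  define G where "G = U ** dg (\<lambda>a. of_real (m a)) ** madj U"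
  define ys where "ys = sorted_list_of_multiset (image_mset m (mset_set (-A)))"
  have ys: "c < y" if "y \<in> set ys" for y using that A(3) unfolding ys_def by auto
  have "mset_set (UNIV :: 'n set) = mset_set A + mset_set (- A)"
    by (subst mset_set_Union[symmetric]) auto
  moreover have "image_mset m (mset_set A) = replicate_mset k c"
  proof -
    have "image_mset m (mset_set A) = image_mset (\<lambda>_. c) (mset_set A)"
      using A(2) by (intro image_mset_cong) auto
    then show ?thesis using A(1) by (simp add: image_mset_const_eq)
  qed
  ultimately have "image_mset m (mset_set UNIV) = mset (replicate k c @ ys)"
    by (simp add: ys_def)
  moreover have "sorted (replicate k c @ ys)"
    using ys by (auto simp: sorted_append ys_def less_imp_le)
  ultimately have ev: "eigvals G = replicate k c @ ys"
    unfolding G_def eigvals_conj_dg[OF U] by (simp only: sorted_list_of_multiset_mset sorted_sort_id)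
  have "length ys = card (- A)" by (simp add: ys_def flip: size_mset)
  \<comment> \<open>k < \<open>CARD('n)\<close> guarantees that eigenvalue number k + 1 is a genuine
    list entry.\<close>
  then have "length ys > 0" using A(1) k by (simp add: Compl_eq_Diff_UNIV card_Diff_subset)
  then have "c < ys ! 0" using ys by simp
  have "lam G j = c" if "j \<in> {1..k}" for j
    using that unfolding lam_def ev by (auto simp: nth_append)
  moreover have "lam G (k + 1) = ys ! 0" unfolding lam_def ev by (simp add: nth_append)
  moreover have "herm G" unfolding G_def by (intro herm_conj herm_dg_of_real)
  ultimately show ?thesis using \<open>c < ys ! 0\<close> k unfolding G_def[symmetric] Sigma_def by auto
qed

subsection \<open>Indices\<close>

lemma idx_less_iff: "idx (a::'n::{finite,linorder}) < idx b \<longleftrightarrow> a < b"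
proof -
  have *: "idx a < idx b" if "a < b" for a b :: 'n
    unfolding idx_def by (rule psubset_card_mono) (use that in \<open>auto intro: less_trans\<close>)
  show ?thesis using *[of a b] *[of b a] by (metis less_asym neqE less_irrefl)
qed

lemma card_idx_less:
  assumes "k \<le> CARD('n::{finite,linorder})"
  shows "card {a::'n. idx a < k} = k"
proof -
  have inj: "inj (idx :: 'n \<Rightarrow> nat)" by (rule injI) (metis idx_less_iff less_irrefl neqE)
  have "range (idx :: 'n \<Rightarrow> nat) \<subseteq> {..<CARD('n)}"
    unfolding idx_def by (auto intro!: psubset_card_mono)
  then have "range (idx :: 'n \<Rightarrow> nat) = {..<CARD('n)}"
    by (intro card_subset_eq) (auto simp: card_image inj)
  then have "idx ` {a::'n. idx a < k} = {..<k}" using assms by (auto simp: set_eq_iff image_iff) (metis lessThan_iff order_less_le_trans rangeE rangeI)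
  then show ?thesis using card_image[of idx "{a::'n. idx a < k}"] inj by (simp add: inj_on_subset)
qed

subsection \<open>The matrix exponential\<close>

lemma mpow_conj_dg:
  fixes V :: "'n::finite cmat"
  assumes "unitary V"
  shows "mpow (V ** dg m ** madj V) j = V ** dg (\<lambda>a. m a ^ j) ** madj V"
proof (induction j)
  case 0
  have "dg (\<lambda>a :: 'n. 1) = mat 1" by (simp add: vec_eq_iff mat_def)
  then show ?case by (simp only: mpow.simps power_0 matrix_mul_rid unitary_right[OF assms])
next
  case (Suc j)
  have "V ** dg m ** madj V ** (V ** dg (\<lambda>a. m a ^ j) ** madj V) = V ** (dg m ** (madj V ** (V ** (dg (\<lambda>a. m a ^ j) ** madj V))))"
    by (simp only: matrix_mul_assoc)
  also have "\<dots> = V ** (dg m ** dg (\<lambda>a. m a ^ j)) ** madj V"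
    unfolding unitary_cancel(1)[OF assms] by (simp only: matrix_mul_assoc)
  finally show ?case unfolding dg_mult using Suc by simp
qed

text \<open>By \<open>conj_dg_nth\<close> each entry is a fixed linear combination of powers of the
  eigenvalues, so the matrix series reduces entrywise to scalar exponential series.\<close>

lemma mexp_conj_dg:
  assumes "unitary V"
  shows "mexp (V ** dg m ** madj V) = V ** dg (\<lambda>a. exp (m a)) ** madj V"
proof -
  have "(\<lambda>j. ((1 / fact j) *\<^sub>R mpow (V ** dg m ** madj V) j) $ a $ b) sums (V ** dg (\<lambda>a. exp (m a)) ** madj V) $ a $ b" for a b
  proof -
    have "(\<lambda>j. \<Sum>i\<in>UNIV. (m i ^ j /\<^sub>R fact j) * (V $ a $ i * cnj (V $ b $ i))) sums
        (\<Sum>i\<in>UNIV. exp (m i) * (V $ a $ i * cnj (V $ b $ i)))"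
      by (intro sums_sum sums_mult2 exp_converges)
    moreover have "((1 / fact j) *\<^sub>R mpow (V ** dg m ** madj V) j) $ a $ b =
        (\<Sum>i\<in>UNIV. (m i ^ j /\<^sub>R fact j) * (V $ a $ i * cnj (V $ b $ i)))" for j
      unfolding mpow_conj_dg[OF assms] vector_scaleR_component conj_dg_nth scaleR_sum_right
      by (simp add: divide_inverse)
    ultimately show ?thesis unfolding conj_dg_nth by presburger
  qed
  then have "(\<lambda>j. (1 / fact j) *\<^sub>R mpow (V ** dg m ** madj V) j) sums (V ** dg (\<lambda>a. exp (m a)) ** madj V)"
    unfolding sums_def by (intro vec_tendstoI) (simp only: sum_component)
  then show ?thesis unfolding mexp_def by (simp add: sums_iff)
qed

text \<open>After diagonalising S with real eigenvalues, conjugating an exponential of an imaginary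
  number negates its exponent, which is also inversion.\<close>

lemma unitary_mexp:
  assumes "herm S"
  shows "unitary (mexp (cscale \<i> S))" and "mexp (cscale (- \<i>) S) = madj (mexp (cscale \<i> S))"
proof -
  obtain V s where V: "unitary V" and S: "S = V ** dg (\<lambda>a. complex_of_real (s a)) ** madj V"
    using spectral_theorem[OF assms] by blast
  have sc: "cscale z S = V ** dg (\<lambda>a. z * of_real (s a)) ** madj V" for z
    unfolding S by (simp only: vec_eq_iff conj_dg_nth cscale_def vec_lambda_beta sum_distrib_left mult.assoc) simp
  define W where "W = V ** dg (\<lambda>a. exp (\<i> * of_real (s a))) ** madj V"
  have W: "mexp (cscale \<i> S) = W" unfolding sc mexp_conj_dg[OF V] W_def ..
  have "madj (dg (\<lambda>a. exp (\<i> * of_real (s a)))) = dg (\<lambda>a. exp (- \<i> * of_real (s a)))"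
    by (auto simp: vec_eq_iff exp_cnj)
  then have W': "madj W = V ** dg (\<lambda>a. exp (- \<i> * of_real (s a))) ** madj V"
    by (simp add: W_def madj_mult matrix_mul_assoc)
  show "mexp (cscale (- \<i>) S) = madj (mexp (cscale \<i> S))"
    unfolding W W' unfolding sc mexp_conj_dg[OF V] by (rule refl)
  have "madj W ** W = V ** (dg (\<lambda>a. exp (- \<i> * of_real (s a))) ** (madj V ** (V ** (dg (\<lambda>a. exp (\<i> * of_real (s a))) ** madj V))))"
    unfolding W' unfolding W_def by (simp only: matrix_mul_assoc)
  also have "\<dots> = V ** (dg (\<lambda>a. exp (- \<i> * of_real (s a))) ** dg (\<lambda>a. exp (\<i> * of_real (s a)))) ** madj V"
    unfolding unitary_cancel(1)[OF V] by (simp only: matrix_mul_assoc)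
  also have "dg (\<lambda>a. exp (- \<i> * of_real (s a))) ** dg (\<lambda>a. exp (\<i> * of_real (s a))) = mat 1"
    unfolding dg_mult by (simp add: vec_eq_iff mat_def exp_add[symmetric])
  finally show "unitary (mexp (cscale \<i> S))"
    unfolding W unitary_def using unitary_right[OF V] by simp
qed

subsection \<open>The effective Hamiltonian\<close>

definition up_mean :: "nat \<Rightarrow> 'n::{finite,linorder} cmat \<Rightarrow> real" where
  "up_mean k M = (\<Sum>a | idx a < k. Re (M $ a $ a)) / real k"

text \<open>A closed formula replacing the description operator in \<open>eff_ham\<close>; it is
  what makes analytic dependence and spectral computation possible.\<close>

definition up_dev :: "nat \<Rightarrow> 'n::{finite,linorder} cmat \<Rightarrow> 'n cmat" where
  "up_dev k M = (\<chi> a b. if idx a < k \<and> idx b < k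
      then M $ a $ b - (if a = b then of_real (up_mean k M) else 0) else 0)"

lemma up_dev_nth: "up_dev k M $ a $ b = (if idx a < k \<and> idx b < k
      then M $ a $ b - (if a = b then of_real (up_mean k M) else 0) else 0)"
  by (simp add: up_dev_def)

lemma herm_diag_real: "herm M \<Longrightarrow> M $ a $ a = of_real (Re (M $ a $ a))"
  unfolding herm_def by (metis Reals_cnj_iff of_real_Re)

lemma mtrace_upper_left:
  assumes "upper_left k M"
  shows "mtrace M = (\<Sum>a | idx a < k. M $ a $ a)"
  unfolding mtrace_def by (rule sum.mono_neutral_right) (use assms in \<open>auto simp: upper_left_def\<close>)

lemma upper_left_up_dev: "upper_left k (up_dev k M)"
  by (auto simp: upper_left_def up_dev_nth)

lemma mtrace_up_dev:
  fixes M :: "'n::{finite,linorder} cmat"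
  assumes M: "herm M" and k: "1 \<le> k" "k \<le> CARD('n)"
  shows "mtrace (up_dev k M) = 0"
proof -
  have "mtrace (up_dev k M) = (\<Sum>a | idx a < k. M $ a $ a - of_real (up_mean k M))"
    unfolding mtrace_upper_left[OF upper_left_up_dev] by (intro sum.cong) (auto simp: up_dev_nth)
  also have "\<dots> = (\<Sum>a | idx a < k. of_real (Re (M $ a $ a))) - of_real (real k * up_mean k M)"
    using card_idx_less[OF k(2)] herm_diag_real[OF M] by (simp add: sum_subtractf)
  also have "real k * up_mean k M = (\<Sum>a | idx a < k. Re (M $ a $ a))"
    using k by (simp add: up_mean_def)
  finally show ?thesis by simp
qed

lemma herm_up_dev:
  assumes "herm M"
  shows "herm (up_dev k M)"
proof -
  have "cnj (M $ j $ i) = M $ i $ j" for i j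
    using assms unfolding herm_def by (rule allE[of _ i]) (erule allE[of _ j], erule sym)
  then show ?thesis unfolding herm_def up_dev_nth by simp
qed

text \<open>Uniqueness comes from the trace of the upper-left block: B and He contribute nothing to
  it, so c can only be the mean of the diagonal there.\<close>

lemma eff_ham_eq:
  fixes M :: "'n::{finite,linorder} cmat"
  assumes M: "herm M" "block_diag k M" and k: "1 \<le> k" "k \<le> CARD('n)"
  shows "eff_ham k M = up_dev k M"
  unfolding eff_ham_def
proof (rule the_equality)
  define B where "B = (\<chi> a b. if \<not> idx a < k \<and> \<not> idx b < k then M $ a $ b else 0)"
  have "lower_right k B" by (auto simp: lower_right_def B_def)
  moreover have "M = B + (\<chi> a b. if a = b \<and> idx a < k then complex_of_real (up_mean k M) else 0) + up_dev k M"
    using M(2) by (auto simp: vec_eq_iff B_def up_dev_nth block_diag_def)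
  ultimately show "\<exists>B c. lower_right k B \<and> upper_left k (up_dev k M) \<and> mtrace (up_dev k M) = 0 \<and>
      M = B + (\<chi> a b. if a = b \<and> idx a < k then complex_of_real c else 0) + up_dev k M"
    using upper_left_up_dev[of k M] mtrace_up_dev[OF M(1) k] by blast
next
  fix He assume "\<exists>B c. lower_right k B \<and> upper_left k He \<and> mtrace He = 0 \<and>
      M = B + (\<chi> a b. if a = b \<and> idx a < k then complex_of_real c else 0) + He"
  then obtain B c where B: "lower_right k B" and He: "upper_left k He" "mtrace He = 0"
    and eq: "M = B + (\<chi> a b. if a = b \<and> idx a < k then complex_of_real c else 0) + He" by blast
  have ent: "M $ a $ b = (if a = b then of_real c else 0) + He $ a $ b" if "idx a < k" "idx b < k" for a b
    using that B unfolding lower_right_def by (subst eq) simp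
  have "(\<Sum>a | idx a < k. M $ a $ a) = (\<Sum>a | idx a < k. of_real c + He $ a $ a)"
    by (intro sum.cong) (auto simp: ent)
  also have "\<dots> = of_real (real k * c)"
    using He card_idx_less[OF k(2)] by (simp add: sum.distrib mtrace_upper_left)
  finally have "Re (\<Sum>a | idx a < k. M $ a $ a) = real k * c" by simp
  then have c: "c = up_mean k M" using k by (simp add: up_mean_def)
  show "He = up_dev k M"
    unfolding vec_eq_iff
  proof (intro allI)
    fix a b
    show "He $ a $ b = up_dev k M $ a $ b"
    proof (cases "idx a < k \<and> idx b < k")
      case True
      then show ?thesis using ent[of a b] c by (simp add: up_dev_nth)
    next
      case False
      then show ?thesis using He(1) by (auto simp: up_dev_nth upper_left_def)
    qed
  qed
qed

lemma up_mean_shift: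
  fixes M D :: "'n::{finite,linorder} cmat"
  assumes "\<And>a. idx a < k \<Longrightarrow> D $ a $ a = of_real e" and k: "1 \<le> k" "k \<le> CARD('n)"
  shows "up_mean k (D + M) = e + up_mean k M"
proof -
  have "(\<Sum>a | idx a < k. Re ((D + M) $ a $ a)) = (\<Sum>a | idx a < k. e + Re (M $ a $ a))"
    by (intro sum.cong) (auto simp: assms(1))
  also have "\<dots> = real k * e + (\<Sum>a | idx a < k. Re (M $ a $ a))"
    using card_idx_less[OF k(2)] by (simp add: sum.distrib)
  finally show ?thesis using k by (simp add: up_mean_def add_divide_distrib)
qed

text \<open>A scalar upper-left block moves only the mean. This links the matrix
  \<open>Bf G\<close>, known to be analytic, with \<open>H0 + Bf G\<close>, whose eigenvalues are
  those of G.\<close>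

lemma up_dev_shift:
  fixes M D :: "'n::{finite,linorder} cmat"
  assumes D: "is_diag D" "\<And>a. idx a < k \<Longrightarrow> D $ a $ a = of_real e" and k: "1 \<le> k" "k \<le> CARD('n)"
  shows "up_dev k (D + M) = up_dev k M"
  using D up_mean_shift[OF D(2) k, of M] by (auto simp: vec_eq_iff up_dev_nth is_diag_def)

definition block_unitary :: "nat \<Rightarrow> 'n::{finite,linorder} cmat \<Rightarrow> bool" where
  "block_unitary k U \<longleftrightarrow> unitary U \<and> block_diag k U"

lemma block_unitary_nth: "block_unitary k U \<Longrightarrow> (idx a < k) \<noteq> (idx b < k) \<Longrightarrow> U $ a $ b = 0"
  by (auto simp: block_unitary_def block_diag_def)

lemma up_mean_conj_dg:
  fixes U :: "'n::{finite,linorder} cmat"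
  assumes U: "block_unitary k U"
  shows "up_mean k (U ** dg (\<lambda>a. of_real (m a)) ** madj U) = (\<Sum>a | idx a < k. m a) / real k"
proof -
  have "(\<Sum>i | idx i < k. Re ((U ** dg (\<lambda>a. of_real (m a)) ** madj U) $ i $ i))
      = (\<Sum>a\<in>UNIV. m a * (\<Sum>i | idx i < k. (cmod (U $ i $ a))\<^sup>2))"
    unfolding Re_conj_dg_diag sum_distrib_left by (rule sum.swap)
  also have "\<dots> = (\<Sum>a\<in>UNIV. if idx a < k then m a else 0)"
  proof (intro sum.cong refl)
    fix a
    have "(\<Sum>i | idx i < k. (cmod (U $ i $ a))\<^sup>2) = (if idx a < k then 1 else 0)"
    proof (cases "idx a < k")
      case True
      have "(\<Sum>i | idx i < k. (cmod (U $ i $ a))\<^sup>2) = (\<Sum>i\<in>UNIV. (cmod (U $ i $ a))\<^sup>2)"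
        by (rule sum.mono_neutral_left) (use True block_unitary_nth[OF U] in auto)
      then show ?thesis using True U unitary_col_sum[of U a] by (simp add: block_unitary_def)
    next
      case False
      then show ?thesis using block_unitary_nth[OF U] by simp
    qed
    then show "m a * (\<Sum>i | idx i < k. (cmod (U $ i $ a))\<^sup>2) = (if idx a < k then m a else 0)" by simp
  qed
  also have "\<dots> = (\<Sum>a | idx a < k. m a)" by (simp add: sum.If_cases)
  finally show ?thesis by (simp add: up_mean_def)
qed

text \<open>A block-diagonal unitary commutes with the projection onto the first k coordinates, so
  cutting out the upper block and subtracting its mean can be done on the eigenvalues.\<close>

lemma up_dev_conj_dg:
  fixes U :: "'n::{finite,linorder} cmat" and m :: "'n \<Rightarrow> real"
  assumes U: "block_unitary k U"
  defines "M \<equiv> U ** dg (\<lambda>a. complex_of_real (m a)) ** madj U"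
  shows "up_dev k M = U ** dg (\<lambda>a. of_real (if idx a < k then m a - up_mean k M else 0)) ** madj U"
proof -
  define c where "c = up_mean k M"
  have "up_dev k M $ i $ j = (U ** dg (\<lambda>a. of_real (if idx a < k then m a - c else 0)) ** madj U) $ i $ j" for i j
  proof (cases "idx i < k \<and> idx j < k")
    case False
    then have "(\<Sum>a\<in>UNIV. of_real (if idx a < k then m a - c else 0) * (U $ i $ a * cnj (U $ j $ a))) = 0"
      using block_unitary_nth[OF U] by (intro sum.neutral) auto
    then show ?thesis using False unfolding conj_dg_nth up_dev_nth by auto
  next
    case True
    have "(\<Sum>a\<in>UNIV. of_real (if idx a < k then m a - c else 0) * (U $ i $ a * cnj (U $ j $ a)))
       = (\<Sum>a\<in>UNIV. of_real (m a) * (U $ i $ a * cnj (U $ j $ a)) - of_real c * (U $ i $ a * cnj (U $ j $ a)))"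
      using block_unitary_nth[OF U] True by (intro sum.cong) (auto simp: left_diff_distrib)
    also have "\<dots> = M $ i $ j - of_real c * (U ** madj U) $ i $ j"
      by (simp add: M_def conj_dg_nth sum_subtractf sum_distrib_left matrix_matrix_mult_def[of U "madj U"])
    also have "U ** madj U = mat 1" using U unitary_right by (auto simp: block_unitary_def)
    finally show ?thesis using True unfolding conj_dg_nth up_dev_nth c_def by (simp add: mat_def)
  qed
  then show ?thesis unfolding vec_eq_iff c_def by blast
qed

lemma norm_up_dev_conj_dg:
  fixes U :: "'n::{finite,linorder} cmat" and m :: "'n \<Rightarrow> real"
  assumes U: "block_unitary k U"
  defines "M \<equiv> U ** dg (\<lambda>a. complex_of_real (m a)) ** madj U"
  shows "(norm (up_dev k M))\<^sup>2 = (\<Sum>a | idx a < k. (m a - up_mean k M)\<^sup>2)"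
proof -
  define c where "c = up_mean k M"
  have "norm (up_dev k M) = norm (dg (\<lambda>a. complex_of_real (if idx a < k then m a - c else 0)))"
    unfolding M_def up_dev_conj_dg[OF U] c_def
  proof -
    have "unitary U" using U by (simp add: block_unitary_def)
    then show "norm (U ** X ** madj U) = norm X" for X :: "'n cmat"
      by (simp only: norm_unitary_left norm_unitary_right unitary_madj)
  qed
  then have "(norm (up_dev k M))\<^sup>2 = (\<Sum>a\<in>UNIV. (cmod (complex_of_real (if idx a < k then m a - c else 0)))\<^sup>2)"
    by (simp only: norm_dg_sq)
  also have "\<dots> = (\<Sum>a\<in>UNIV. if idx a < k then (m a - c)\<^sup>2 else 0)"
    by (intro sum.cong refl) (simp add: norm_of_real)
  also have "\<dots> = (\<Sum>a | idx a < k. (m a - c)\<^sup>2)" by (simp add: sum.If_cases)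
  finally show ?thesis by (simp add: c_def)
qed

text \<open>A Weyl-type bound inside the lower block. In the eigenbasis of the first matrix, a lower
  diagonal entry of the second is an average of its lower eigenvalues alone, because the transition
  matrix Q has no entry from row b into the upper columns.\<close>

lemma lower_block_eigenvalue_ge:
  fixes U U0 :: "'n::{finite,linorder} cmat"
  assumes U: "block_unitary k U" and U0: "block_unitary k U0"
    and ge: "\<And>b. \<not> idx b < k \<Longrightarrow> g \<le> m0 b" and b: "\<not> idx b < k"
  shows "g - norm (U ** dg (\<lambda>a. of_real (m a)) ** madj U - U0 ** dg (\<lambda>a. of_real (m0 a)) ** madj U0) \<le> m b"
proof -
  define Q where "Q = madj U ** U0"
  define X where "X = Q ** dg (\<lambda>a. of_real (m0 a)) ** madj Q"
  have unU: "unitary U" and Q: "unitary Q"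
    using U U0 unitary_mult unitary_madj by (auto simp: block_unitary_def Q_def)
  have Qb: "Q $ b $ a = 0" if "idx a < k" for a
  proof -
    have *: "cnj (U $ i $ b) * U0 $ i $ a = 0" for i
      using that b block_unitary_nth[OF U, of i b] block_unitary_nth[OF U0, of i a] by (cases "idx i < k") simp_all
    show ?thesis by (simp only: Q_def matrix_matrix_mult_def vec_lambda_beta madj_nth * sum.neutral_const)
  qed
  have "U0 ** dg (\<lambda>a. of_real (m0 a)) ** madj U0 = U ** X ** madj U"
    by (simp add: X_def Q_def madj_mult matrix_mul_assoc unitary_cancel[OF unU] unitary_right[OF unU])
  then have "norm (U ** dg (\<lambda>a. of_real (m a)) ** madj U - U0 ** dg (\<lambda>a. of_real (m0 a)) ** madj U0)
      = norm (dg (\<lambda>a. of_real (m a)) - X)"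
    using norm_conj_diff[OF unU] by simp
  moreover have "cmod ((dg (\<lambda>a. of_real (m a)) - X) $ b $ b) \<le> norm (dg (\<lambda>a. of_real (m a)) - X)"
    by (rule cmod_nth_le_norm)
  moreover have "Re (X $ b $ b) - m b \<le> cmod ((dg (\<lambda>a. of_real (m a)) - X) $ b $ b)"
    using abs_Re_le_cmod[of "(dg (\<lambda>a. of_real (m a)) - X) $ b $ b"] by simp
  moreover have "g \<le> Re (X $ b $ b)"
  proof -
    have "g = (\<Sum>a\<in>UNIV. g * (cmod (Q $ b $ a))\<^sup>2)"
      using unitary_row_sum[OF Q, of b] by (simp add: sum_distrib_left[symmetric])
    also have "\<dots> \<le> (\<Sum>a\<in>UNIV. m0 a * (cmod (Q $ b $ a))\<^sup>2)"
    proof (rule sum_mono)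
      fix a
      show "g * (cmod (Q $ b $ a))\<^sup>2 \<le> m0 a * (cmod (Q $ b $ a))\<^sup>2"
        using Qb[of a] ge[of a] by (cases "idx a < k") (auto intro: mult_right_mono)
    qed
    finally show ?thesis unfolding X_def Re_conj_dg_diag .
  qed
  ultimately show ?thesis by linarith
qed

subsection \<open>The distance to the degeneracy stratum\<close>

text \<open>The bathtub principle: with the threshold taken as the maximum of x on A, moving weight
  out of A never moves it to a smaller value, and the total weight is preserved.\<close>

lemma sum_le_weighted_sum:
  fixes x p :: "'n::finite \<Rightarrow> real"
  assumes p: "\<And>a. 0 \<le> p a" "\<And>a. p a \<le> 1" "(\<Sum>a\<in>UNIV. p a) = real (card A)"
    and x: "\<And>a b. a \<in> A \<Longrightarrow> b \<notin> A \<Longrightarrow> x a \<le> x b" and A: "A \<noteq> {}"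
  shows "(\<Sum>a\<in>A. x a) \<le> (\<Sum>a\<in>UNIV. x a * p a)"
proof -
  define \<tau> where "\<tau> = Max (x ` A)"
  have lo: "x a \<le> \<tau>" if "a \<in> A" for a using that by (simp add: \<tau>_def)
  have hi: "\<tau> \<le> x b" if "b \<notin> A" for b using x[OF _ that] A by (simp add: \<tau>_def)
  have "(\<Sum>a\<in>UNIV. \<tau> * (p a - (if a \<in> A then 1 else 0))) \<le> (\<Sum>a\<in>UNIV. x a * (p a - (if a \<in> A then 1 else 0)))"
  proof (rule sum_mono)
    fix a
    show "\<tau> * (p a - (if a \<in> A then 1 else 0)) \<le> x a * (p a - (if a \<in> A then 1 else 0))"
    proof (cases "a \<in> A")
      case True
      then show ?thesis using lo[of a] p(2)[of a] by (simp add: mult_right_mono_neg)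
    next
      case False
      then show ?thesis using hi[of a] p(1)[of a] by (simp add: mult_right_mono)
    qed
  qed
  moreover have "(\<Sum>a\<in>UNIV. \<tau> * (p a - (if a \<in> A then 1 else 0))) = 0"
    unfolding sum_distrib_left[symmetric] sum_subtractf by (simp add: p(3) sum.If_cases)
  moreover have "(\<Sum>a\<in>UNIV. x a * (p a - (if a \<in> A then 1 else 0))) = (\<Sum>a\<in>UNIV. x a * p a) - (\<Sum>a\<in>A. x a)"
  proof -
    have "x a * (p a - (if a \<in> A then 1 else 0)) = x a * p a - (if a \<in> A then x a else 0)" for a
      by (simp add: right_diff_distrib)
    then show ?thesis by (simp add: sum_subtractf sum.If_cases)
  qed
  ultimately show ?thesis by linarith
qed

text \<open>Arguing by contradiction is what controls the competitor: being closer than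
  \<open>\<eta>\<close>, it has lowest eigenvalue e at most \<open>c + 2 * \<eta>\<close>, and this
  together with the gap makes (m - e) squared smallest on A.\<close>

lemma dist_Sigma_ge:
  fixes W :: "'n::finite cmat" and m :: "'n \<Rightarrow> real"
  assumes W: "unitary W" and A: "card A = k" and k: "1 \<le> k" "k < CARD('n)"
    and c: "(\<Sum>a\<in>A. m a) = real k * c" and \<eta>: "0 \<le> \<eta>" "\<eta>\<^sup>2 = (\<Sum>a\<in>A. (m a - c)\<^sup>2)"
    and gap: "\<And>b. b \<notin> A \<Longrightarrow> c + 5 * \<eta> \<le> m b" and G: "G \<in> Sigma k"
  shows "\<eta> \<le> norm (W ** dg (\<lambda>a. of_real (m a)) ** madj W - G)"
proof (rule ccontr)
  assume less: "\<not> \<eta> \<le> norm (W ** dg (\<lambda>a. of_real (m a)) ** madj W - G)"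
  have "herm G" using G by (simp add: Sigma_def)
  then obtain V \<mu> where V: "unitary V" and GV: "G = V ** dg (\<lambda>a. complex_of_real (\<mu> a)) ** madj V"
    using spectral_theorem by blast
  obtain A2 e where A2: "card A2 = k" "\<And>a. a \<in> A2 \<Longrightarrow> \<mu> a = e" "\<And>b. b \<notin> A2 \<Longrightarrow> e < \<mu> b"
    using Sigma_imp_eigen_split[OF V, of \<mu> k] G k unfolding GV by blast
  define Q where "Q = madj W ** V"
  have Q: "unitary Q" unfolding Q_def using W V unitary_mult unitary_madj by blast
  define X where "X = Q ** dg (\<lambda>a. complex_of_real (\<mu> a)) ** madj Q"
  have "G = W ** X ** madj W"
    unfolding GV by (simp add: X_def Q_def madj_mult matrix_mul_assoc unitary_cancel[OF W] unitary_right[OF W])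
  then have nX: "norm (W ** dg (\<lambda>a. of_real (m a)) ** madj W - G) = norm (dg (\<lambda>a. of_real (m a)) - X)"
    using norm_conj_diff[OF W] by simp
  have lt: "norm (dg (\<lambda>a. of_real (m a)) - X) < \<eta>" using less nX by simp
  have A0: "A \<noteq> {}" using A k by auto
  have dev: "\<bar>m a - c\<bar> \<le> \<eta>" if "a \<in> A" for a
  proof -
    have "(m a - c)\<^sup>2 \<le> \<eta>\<^sup>2" unfolding \<eta>(2) by (rule member_le_sum) (use that in auto)
    then show ?thesis using \<eta>(1) by (simp add: abs_le_square_iff[symmetric])
  qed
  have e: "e \<le> c + 2 * \<eta>"
  proof -
    obtain a where a: "a \<in> A" using A0 by blast
    have "e = (\<Sum>b\<in>UNIV. e * (cmod (Q $ a $ b))\<^sup>2)"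
      using unitary_row_sum[OF Q, of a] by (simp add: sum_distrib_left[symmetric])
    also have "\<dots> \<le> (\<Sum>b\<in>UNIV. \<mu> b * (cmod (Q $ a $ b))\<^sup>2)"
    proof (intro sum_mono mult_right_mono)
      fix b show "e \<le> \<mu> b" using A2(2,3)[of b] by (cases "b \<in> A2") auto
    qed auto
    also have "\<dots> = Re (X $ a $ a)" unfolding X_def Re_conj_dg_diag ..
    also have "\<dots> \<le> m a + norm (dg (\<lambda>a. of_real (m a)) - X)"
      using abs_Re_le_cmod[of "(dg (\<lambda>a. of_real (m a)) - X) $ a $ a"]
        cmod_nth_le_norm[of "dg (\<lambda>a. of_real (m a)) - X" a a] by simp
    finally show ?thesis using dev[OF a] lt by linarith
  qed
  \<comment> \<open>The diagonal of the projection onto the lowest eigenspace of G, written in the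
    eigenbasis W; its trace is k.\<close>
  define p where "p = (\<lambda>i. \<Sum>b\<in>A2. (cmod (Q $ i $ b))\<^sup>2)"
  have p: "0 \<le> p i" "p i \<le> 1" for i
  proof -
    show "0 \<le> p i" by (simp add: p_def sum_nonneg)
    have "p i \<le> (\<Sum>b\<in>UNIV. (cmod (Q $ i $ b))\<^sup>2)" unfolding p_def by (rule sum_mono2) auto
    then show "p i \<le> 1" using unitary_row_sum[OF Q] by simp
  qed
  have psum: "(\<Sum>i\<in>UNIV. p i) = real (card A)"
  proof -
    have "(\<Sum>i\<in>UNIV. p i) = (\<Sum>b\<in>A2. \<Sum>i\<in>UNIV. (cmod (Q $ i $ b))\<^sup>2)" unfolding p_def by (rule sum.swap)
    then show ?thesis using A A2(1) unitary_col_sum[OF Q] by simp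
  qed
  have "\<eta>\<^sup>2 \<le> (\<Sum>a\<in>A. (m a - e)\<^sup>2)"
  proof -
    have "(m a - e)\<^sup>2 = (m a - c)\<^sup>2 + (c - e)\<^sup>2 + 2 * (c - e) * (m a - c)" for a
      by (simp add: power2_eq_square algebra_simps)
    then have "(\<Sum>a\<in>A. (m a - e)\<^sup>2) = \<eta>\<^sup>2 + real k * (c - e)\<^sup>2 + 2 * (c - e) * (\<Sum>a\<in>A. m a - c)"
      by (simp add: sum.distrib \<eta>(2) A sum_distrib_left)
    \<comment> \<open>c is the mean of m over A, so the cross term vanishes and replacing c by e can
      only increase the sum of squares.\<close>
    also have "(\<Sum>a\<in>A. m a - c) = 0" by (simp add: sum_subtractf c A)
    finally show ?thesis by simp
  qed
  also have "\<dots> \<le> (\<Sum>i\<in>UNIV. (m i - e)\<^sup>2 * p i)"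
  proof (rule sum_le_weighted_sum[OF p psum _ A0])
    fix a b assume ab: "a \<in> A" "b \<notin> A"
    \<comment> \<open>Origin of the factor 5: m b >= c + 5 eta, m a >= c - eta and e <= c + 2 eta
      give m b + m a - 2 e >= 0.\<close>
    have "0 \<le> (m b - m a) * (m b + m a - 2 * e)"
      using dev[OF ab(1)] gap[OF ab(2)] e \<eta>(1) by (intro mult_nonneg_nonneg) linarith+
    also have "\<dots> = (m b - e)\<^sup>2 - (m a - e)\<^sup>2" by (simp add: power2_eq_square algebra_simps)
    finally show "(m a - e)\<^sup>2 \<le> (m b - e)\<^sup>2" by simp
  qed
  also have "\<dots> \<le> (norm (dg (\<lambda>a. of_real (m a)) - X))\<^sup>2"
  proof -
    \<comment> \<open>Multiplying by Q keeps the norm and puts the eigenvectors of G into the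
      columns; only those with eigenvalue e are retained.\<close>
    have "norm (dg (\<lambda>a. of_real (m a)) - X) = norm ((dg (\<lambda>a. of_real (m a)) - X) ** Q)"
      using Q by simp
    also have "(dg (\<lambda>a. of_real (m a)) - X) ** Q = dg (\<lambda>a. of_real (m a)) ** Q - Q ** dg (\<lambda>a. of_real (\<mu> a))"
      by (simp add: matrix_mult_diff_rdistrib X_def unitary_cancel[OF Q])
    finally have "(norm (dg (\<lambda>a. of_real (m a)) - X))\<^sup>2 =
        (\<Sum>i\<in>UNIV. \<Sum>b\<in>UNIV. (cmod (of_real (m i) * Q $ i $ b - Q $ i $ b * of_real (\<mu> b)))\<^sup>2)"
      by (simp add: norm_cmat_sq dg_mult_nth mult_dg_nth)
    also have "\<dots> \<ge> (\<Sum>i\<in>UNIV. \<Sum>b\<in>A2. (cmod (of_real (m i) * Q $ i $ b - Q $ i $ b * of_real (\<mu> b)))\<^sup>2)"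
      by (intro sum_mono sum_mono2) auto
    also have "(\<Sum>i\<in>UNIV. \<Sum>b\<in>A2. (cmod (of_real (m i) * Q $ i $ b - Q $ i $ b * of_real (\<mu> b)))\<^sup>2)
        = (\<Sum>i\<in>UNIV. (m i - e)\<^sup>2 * p i)"
      unfolding p_def sum_distrib_left
    proof (intro sum.cong refl)
      fix i b assume "b \<in> A2"
      have "of_real (m i) * Q $ i $ b - Q $ i $ b * of_real (\<mu> b) = of_real (m i - e) * Q $ i $ b"
        using A2(2)[OF \<open>b \<in> A2\<close>] by (simp add: algebra_simps)
      then show "(cmod (of_real (m i) * Q $ i $ b - Q $ i $ b * of_real (\<mu> b)))\<^sup>2 = (m i - e)\<^sup>2 * (cmod (Q $ i $ b))\<^sup>2"
        by (simp only: norm_mult norm_of_real power_mult_distrib power2_abs)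
    qed
    finally show ?thesis .
  qed
  finally have "\<eta> \<le> norm (dg (\<lambda>a. of_real (m a)) - X)" by (rule power2_le_imp_le) simp
  then show False using lt by simp
qed

text \<open>The strict gap is a separate hypothesis since for \<open>\<eta>\<close> = 0 the other
  gives only c <= m b, while the flattened matrix \<open>G1\<close> must have its eigenvalue c
  separated from the rest.\<close>

lemma infdist_Sigma:
  fixes W :: "'n::finite cmat" and m :: "'n \<Rightarrow> real"
  assumes W: "unitary W" and A: "card A = k" and k: "1 \<le> k" "k < CARD('n)"
    and c: "(\<Sum>a\<in>A. m a) = real k * c" and \<eta>: "0 \<le> \<eta>" "\<eta>\<^sup>2 = (\<Sum>a\<in>A. (m a - c)\<^sup>2)"
    and gap: "\<And>b. b \<notin> A \<Longrightarrow> c + 5 * \<eta> \<le> m b" "\<And>b. b \<notin> A \<Longrightarrow> c < m b"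
  shows "infdist (W ** dg (\<lambda>a. of_real (m a)) ** madj W) (Sigma k) = \<eta>"
proof (rule antisym)
  define m1 where "m1 = (\<lambda>a. if a \<in> A then c else m a)"
  define G1 where "G1 = W ** dg (\<lambda>a. of_real (m1 a)) ** madj W"
  have G1: "G1 \<in> Sigma k"
    unfolding G1_def by (rule Sigma_if_eigen_split[OF W A _ _ k, of m1 c]) (auto simp: m1_def gap(2))
  have "dist (W ** dg (\<lambda>a. of_real (m a)) ** madj W) G1 = norm (dg (\<lambda>a. of_real (m a - m1 a)))"
  proof -
    have "dg (\<lambda>a. complex_of_real (m a)) - dg (\<lambda>a. of_real (m1 a)) = dg (\<lambda>a. of_real (m a - m1 a))"
      by (simp add: vec_eq_iff)
    then show ?thesis unfolding dist_norm G1_def norm_conj_diff[OF W] by simp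
  qed
  moreover have "(norm (dg (\<lambda>a. complex_of_real (m a - m1 a))))\<^sup>2 = \<eta>\<^sup>2"
  proof -
    have "(\<Sum>a\<in>UNIV. (cmod (complex_of_real (m a - m1 a)))\<^sup>2) = (\<Sum>a\<in>UNIV. if a \<in> A then (m a - c)\<^sup>2 else 0)"
      by (intro sum.cong refl) (simp add: m1_def flip: of_real_diff)
    then show ?thesis unfolding norm_dg_sq \<eta>(2) by (simp add: sum.If_cases)
  qed
  ultimately have "dist (W ** dg (\<lambda>a. of_real (m a)) ** madj W) G1 = \<eta>" using \<eta>(1) by simp
  then show "infdist (W ** dg (\<lambda>a. of_real (m a)) ** madj W) (Sigma k) \<le> \<eta>"
    using infdist_le[OF G1, of "W ** dg (\<lambda>a. of_real (m a)) ** madj W"] by simp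
  have "\<eta> \<le> dist (W ** dg (\<lambda>a. of_real (m a)) ** madj W) G" if "G \<in> Sigma k" for G
    unfolding dist_norm using dist_Sigma_ge[OF W A k c \<eta> gap(1) that] .
  \<comment> \<open>\<open>infdist\<close> to the empty set is 0 by convention; \<open>G1\<close>
    shows that \<open>Sigma k\<close> is nonempty.\<close>
  then show "\<eta> \<le> infdist (W ** dg (\<lambda>a. of_real (m a)) ** madj W) (Sigma k)"
    unfolding infdist_def using G1 by (auto intro: cINF_greatest)
qed

section \<open>The k lowest eigenvalues read off the SW decomposition\<close>

lemma sum_lam_eq:
  fixes m :: "'n::finite \<Rightarrow> real"
  assumes eq: "image_mset m (mset_set A) = mset (take k (eigvals G))" and k: "k \<le> length (eigvals G)"
  shows "(\<Sum>j=1..k. f (lam G j)) = (\<Sum>a\<in>A. f (m a))"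
proof -
  have "(\<Sum>j=1..k. f (lam G j)) = (\<Sum>i<k. f (eigvals G ! i))"
    by (simp add: lam_def sum.atLeast1_atMost_eq)
  also have "\<dots> = sum_list (map f (take k (eigvals G)))"
    using k by (simp add: sum_list_sum_nth atLeast0LessThan)
  also have "\<dots> = sum_mset (image_mset f (mset (take k (eigvals G))))"
    by (simp only: mset_map[symmetric] sum_mset_sum_list)
  also have "\<dots> = (\<Sum>a\<in>A. f (m a))"
    unfolding eq[symmetric] by (simp add: sum_unfold_sum_mset image_mset.compositionality o_def)
  finally show ?thesis .
qed

text \<open>An eigenvector of one of the k lowest eigenvalues lies in the span of the first k columns of
  W, whereas the column of W U with a lower index b is orthogonal to that span.\<close>

lemma lower_block_eigenvalue_not_low:
  fixes U W :: "'n::{finite,linorder} cmat" and m :: "'n \<Rightarrow> real"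
  assumes W: "unitary W" and U: "block_unitary k U"
    and G: "G = W ** (U ** dg (\<lambda>a. of_real (m a)) ** madj U) ** madj W"
    and span: "first_cols_span k W = low_spec k G" and b: "\<not> idx b < k" and j: "j \<in> {1..k}"
  shows "m b \<noteq> lam G j"
proof
  assume mb: "m b = lam G j"
  define V where "V = W ** U"
  have unU: "unitary U" using U by (simp add: block_unitary_def)
  have V: "unitary V" unfolding V_def by (rule unitary_mult[OF W unU])
  have "G = V ** dg (\<lambda>a. of_real (m a)) ** madj V"
    unfolding G V_def madj_mult by (simp only: matrix_mul_assoc)
  then have GV: "G ** V = V ** dg (\<lambda>a. of_real (m a))"
    by (simp only: unitary_cancel[OF V])
  define v where "v = (\<chi> i. V $ i $ b)"
  have Gv: "G *v v = (\<chi> i. of_real (lam G j) * v $ i)"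
  proof -
    have "(G *v v) $ i = (G ** V) $ i $ b" for i
      by (simp add: matrix_vector_mult_def matrix_matrix_mult_def v_def)
    then show ?thesis unfolding GV vec_eq_iff mult_dg_nth by (simp add: v_def mb mult.commute)
  qed
  \<comment> \<open>\<open>low_spec\<close> wants one summand for each of the k eigenvalues; v fills
    slot j and the other slots are 0.\<close>
  define w where "w = (\<lambda>j'. if j' = j then v else 0)"
  have "G *v w j' = (\<chi> i. of_real (lam G j') * w j' $ i)" for j'
    using Gv by (cases "j' = j") (simp_all add: w_def vec_eq_iff)
  moreover have "v = (\<Sum>j'=1..k. w j')" using j by (simp add: w_def)
  ultimately have "v \<in> low_spec k G" unfolding low_spec_def by blast
  then obtain c where c: "v = (\<chi> i. \<Sum>a\<in>{a. idx a < k}. W $ i $ a * c a)"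
    unfolding span[symmetric] first_cols_span_def by blast
  \<comment> \<open>Upper entries of column b vanish by block structure, lower ones because the
    later columns of W are orthogonal to the first k; a column of norm 1 cannot be zero.\<close>
  have "U $ d $ b = 0" for d
  proof (cases "idx d < k")
    case True
    then show ?thesis using b by (simp add: block_unitary_nth[OF U])
  next
    case False
    have "U = madj W ** V" unfolding V_def by (simp only: unitary_cancel[OF W])
    then have "U $ d $ b = (\<Sum>i\<in>UNIV. cnj (W $ i $ d) * v $ i)"
      by (simp add: matrix_matrix_mult_def v_def)
    also have "\<dots> = (\<Sum>i\<in>UNIV. \<Sum>a\<in>{a. idx a < k}. cnj (W $ i $ d) * W $ i $ a * c a)"
      unfolding c by (simp add: sum_distrib_left mult.assoc)
    also have "\<dots> = (\<Sum>a\<in>{a. idx a < k}. (madj W ** W) $ d $ a * c a)"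
      by (subst sum.swap) (simp add: matrix_matrix_mult_def sum_distrib_right)
    also have "\<dots> = 0"
      using W False unfolding unitary_def by (intro sum.neutral) (auto simp: mat_def)
    finally show ?thesis .
  qed
  then show False using unitary_col_sum[OF unU, of b] by simp
qed

text \<open>Since the diagonal is nondecreasing, any index that misses the lowest value has all k
  indices carrying it strictly below, hence position at least k.\<close>

lemma diag_Sigma_upper:
  fixes D :: "'n::{finite,linorder} cmat"
  assumes D: "is_diag D" "\<And>a b. a \<le> b \<Longrightarrow> Re (D $ a $ a) \<le> Re (D $ b $ b)" "D \<in> Sigma k"
    and k: "1 \<le> k" "k < CARD('n)"
  shows "\<exists>e. \<forall>a. idx a < k \<longrightarrow> D $ a $ a = of_real e"
proof -
  have hD: "herm D" using D(3) by (simp add: Sigma_def)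
  define d where "d = (\<lambda>a. Re (D $ a $ a))"
  have Dd: "D = mat 1 ** dg (\<lambda>a. complex_of_real (d a)) ** madj (mat 1)"
  proof -
    have 1: "madj (mat 1 :: 'n cmat) = mat 1" by (auto simp: vec_eq_iff mat_def)
    have "D $ i $ j = dg (\<lambda>a. complex_of_real (d a)) $ i $ j" for i j
      using D(1) herm_diag_real[OF hD, of i] unfolding is_diag_def d_def by (cases "i = j") simp_all
    then have "D = dg (\<lambda>a. complex_of_real (d a))" unfolding vec_eq_iff by blast
    then show ?thesis unfolding 1 by (simp only: matrix_mul_lid matrix_mul_rid)
  qed
  obtain A e where A: "card A = k" "\<And>a. a \<in> A \<Longrightarrow> d a = e" "\<And>b. b \<notin> A \<Longrightarrow> e < d b"
    using Sigma_imp_eigen_split[OF unitary_mat_1, of d k] D(3) k unfolding Dd[symmetric] by blast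
  have "a \<in> A" if a: "idx a < k" for a
  proof (rule ccontr)
    assume "a \<notin> A"
    have "A \<subseteq> {b. b < a}"
    proof
      fix b assume "b \<in> A"
      then have "d b < d a" using A(2)[of b] A(3)[OF \<open>a \<notin> A\<close>] by simp
      then show "b \<in> {b. b < a}" using D(2)[of a b] unfolding d_def by (metis leD mem_Collect_eq not_le)
    qed
    then have "k \<le> idx a" unfolding A(1)[symmetric] idx_def by (intro card_mono) auto
    then show False using a by simp
  qed
  then have "D $ a $ a = of_real e" if "idx a < k" for a
    using that A(2)[of a] herm_diag_real[OF hD, of a] by (simp add: d_def)
  then show ?thesis by blast
qed

text \<open>Diagonalising within the blocks keeps track of the block each eigenvalue belongs to. The
  span condition keeps the k lowest values out of the lower block, and counting then assigns them to
  the upper one.\<close>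

lemma SW_spectral:
  fixes H0 G :: "'n::{finite,linorder} cmat"
  assumes SW: "SW_data k H0 V0 U0 Sf Bf" and G: "G \<in> V0" and H0: "herm H0" "is_diag H0"
    and k: "1 \<le> k" "k \<le> CARD('n)"
  obtains W U m where "unitary W" "block_unitary k U"
    "H0 + Bf G = U ** dg (\<lambda>a. complex_of_real (m a)) ** madj U"
    "G = W ** (H0 + Bf G) ** madj W"
    "image_mset m (mset_set {a. idx a < k}) = mset (take k (eigvals G))"
    "\<And>a b. idx a < k \<Longrightarrow> \<not> idx b < k \<Longrightarrow> m a < m b"
    "herm (Bf G)" "block_diag k (Bf G)" "length (eigvals G) = CARD('n)"
proof -
  have U0: "U0 \<subseteq> SW_pairs k" using SW unfolding SW_data_def by (blast dest: openin_imp_subset)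
  have pair: "(Sf G, Bf G) \<in> U0" and conj: "G = SW_conj H0 (Sf G) (Bf G)"
    and span: "first_cols_span k (mexp (cscale \<i> (Sf G))) = low_spec k G"
    using SW G unfolding SW_data_def by blast+
  have hS: "herm (Sf G)" and hB: "herm (Bf G)" "block_diag k (Bf G)"
    using pair U0 unfolding SW_pairs_def by blast+
  define W where "W = mexp (cscale \<i> (Sf G))"
  have W: "unitary W" unfolding W_def by (rule unitary_mexp(1)[OF hS])
  have GW: "G = W ** (H0 + Bf G) ** madj W"
    using conj unfolding SW_conj_def W_def unitary_mexp(2)[OF hS] .
  have hM: "herm (H0 + Bf G)" using H0(1) hB(1) by (simp add: herm_iff_madj madj_add)
  have "(H0 + Bf G) $ a $ b = 0" if "(idx a < k) \<noteq> (idx b < k)" for a b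
  proof -
    have "a \<noteq> b" using that by auto
    then show ?thesis using that H0(2) hB(2) unfolding is_diag_def block_diag_def by simp
  qed
  then obtain U m where U: "unitary U" "\<forall>a b. (idx a < k) \<noteq> (idx b < k) \<longrightarrow> U $ a $ b = 0"
    and M: "H0 + Bf G = U ** dg (\<lambda>a. complex_of_real (m a)) ** madj U"
    using spectral_theorem_block[OF hM, of "\<lambda>a. idx a < k"] by blast
  have bU: "block_unitary k U" using U by (simp add: block_unitary_def block_diag_def)
  have GU: "G = W ** (U ** dg (\<lambda>a. complex_of_real (m a)) ** madj U) ** madj W"
    using GW unfolding M .
  then have "G = (W ** U) ** dg (\<lambda>a. complex_of_real (m a)) ** madj (W ** U)"
    by (simp only: madj_mult matrix_mul_assoc)
  then have ms: "mset (eigvals G) = image_mset m (mset_set UNIV)"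
    using mset_eigvals_conj_dg[OF unitary_mult[OF W U(1)], of m] by simp
  have len: "length (eigvals G) = CARD('n)" using arg_cong[OF ms, of size] by simp
  have avoid: "m b \<notin> set (take k (eigvals G))" if b: "b \<notin> {a. idx a < k}" for b
  proof
    assume "m b \<in> set (take k (eigvals G))"
    then obtain i where i: "i < k" "m b = eigvals G ! i" by (auto simp: in_set_conv_nth)
    have "m b \<noteq> lam G (Suc i)"
      by (rule lower_block_eigenvalue_not_low[OF W bU GU span[folded W_def]]) (use b i in auto)
    then show False using i by (simp add: lam_def)
  qed
  note * = mset_take_eq_if_complement_avoids[OF sorted_eigvals ms card_idx_less[OF k(2)] avoid]
  show ?thesis
    by (rule that[OF W bU M GW *(1) _ hB len]) (use *(2) in auto)
qed

lemma Dk_eq_norm_up_dev: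
  fixes U :: "'n::{finite,linorder} cmat"
  assumes U: "block_unitary k U" and M: "M = U ** dg (\<lambda>a. complex_of_real (m a)) ** madj U"
    and low: "image_mset m (mset_set {a. idx a < k}) = mset (take k (eigvals G))" "k \<le> length (eigvals G)"
  shows "Dk k G = norm (up_dev k M) / sqrt (real k)"
proof -
  have "(\<Sum>j=1..k. lam G j) / real k = up_mean k M"
    unfolding M up_mean_conj_dg[OF U] sum_lam_eq[OF low, of "\<lambda>x. x"] ..
  then have "Dk k G = sqrt ((\<Sum>j=1..k. (lam G j - up_mean k M)\<^sup>2) / real k)"
    by (simp add: Dk_def)
  also have "(\<Sum>j=1..k. (lam G j - up_mean k M)\<^sup>2) = (norm (up_dev k M))\<^sup>2"
    unfolding sum_lam_eq[OF low, of "\<lambda>x. (x - up_mean k M)\<^sup>2"] using norm_up_dev_conj_dg[OF U, of m] M by simp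
  finally show ?thesis by (simp add: real_sqrt_divide)
qed

section \<open>Norms bounded by entries and by coordinates\<close>

lemma norm_cmat_le_sum: "norm (X :: 'n::finite cmat) \<le> (\<Sum>(i, j)\<in>UNIV. cmod (X $ i $ j))"
proof -
  have "norm X \<le> (\<Sum>i\<in>UNIV. norm (X $ i))" unfolding norm_vec_def[of X] by (intro L2_set_le_sum) simp
  also have "\<dots> \<le> (\<Sum>i\<in>UNIV. \<Sum>j\<in>UNIV. cmod (X $ i $ j))"
    unfolding norm_vec_def[of "X $ _"] by (intro sum_mono L2_set_le_sum) simp
  also have "\<dots> = (\<Sum>(i, j)\<in>UNIV. cmod (X $ i $ j))"
    by (simp add: sum.cartesian_product UNIV_Times_UNIV[symmetric] del: UNIV_Times_UNIV)
  finally show ?thesis .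
qed

text \<open>The triangle inequality suffices in place of Parseval, as growth is compared only up to
  constants. Orthonormality makes E injective on J, so that the span of the image can be indexed by
  J.\<close>

lemma norm_le_sum_coordinates:
  fixes E :: "nat \<Rightarrow> 'a::euclidean_space"
  assumes J: "finite J" and on: "\<And>i j. i \<in> J \<Longrightarrow> j \<in> J \<Longrightarrow> E i \<bullet> E j = (if i = j then 1 else 0)"
    and x: "x \<in> span (E ` J)"
  shows "norm x \<le> (\<Sum>j\<in>J. \<bar>E j \<bullet> x\<bar>)"
proof -
  have inj: "inj_on E J"
  proof (rule inj_onI)
    fix i j assume ij: "i \<in> J" "j \<in> J" "E i = E j"
    then show "i = j" using on[of i i] on[of i j] by (auto split: if_splits)
  qed
  obtain u where "x = (\<Sum>v\<in>E ` J. u v *\<^sub>R v)" using x J by (auto simp: span_finite)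
  then have u: "x = (\<Sum>j\<in>J. u (E j) *\<^sub>R E j)" by (simp add: sum.reindex[OF inj])
  have "E j \<bullet> x = u (E j)" if j: "j \<in> J" for j
  proof -
    have "E j \<bullet> x = (\<Sum>i\<in>J. u (E i) * (E j \<bullet> E i))" by (simp add: u inner_sum_right)
    also have "\<dots> = (\<Sum>i\<in>J. if j = i then u (E i) else 0)"
      using on[OF j] by (intro sum.cong) auto
    finally show ?thesis using J j by simp
  qed
  moreover have "norm (E j) = 1" if "j \<in> J" for j using on[OF that that] by (simp add: norm_eq_sqrt_inner)
  moreover have "norm x \<le> (\<Sum>j\<in>J. norm (u (E j) *\<^sub>R E j))" by (subst u) (rule norm_sum)
  ultimately show ?thesis by simp
qed

subsection \<open>Analytic curves of matrices\<close>

text \<open>Ranging over all real-linear functionals covers at once the real and imaginary parts of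
  the entries and the coordinates with respect to E.\<close>

definition hol_mat :: "(real \<Rightarrow> 'n::finite cmat) \<Rightarrow> bool" where
  "hol_mat X \<longleftrightarrow> (\<forall>v. hol_at0 (\<lambda>t. complex_of_real (X t \<bullet> v)))"

lemma inner_axis_axis: "(X :: 'n::finite cmat) \<bullet> axis i (axis j u) = X $ i $ j \<bullet> u"
  by (simp add: inner_axis)

lemma hol_mat_Re_Im:
  assumes "hol_mat X"
  shows "hol_at0 (\<lambda>t. complex_of_real (Re (X t $ i $ j)))" "hol_at0 (\<lambda>t. complex_of_real (Im (X t $ i $ j)))"
proof -
  have "hol_at0 (\<lambda>t. complex_of_real (X t \<bullet> axis i (axis j 1)))" "hol_at0 (\<lambda>t. complex_of_real (X t \<bullet> axis i (axis j \<i>)))"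
    using assms unfolding hol_mat_def by blast+
  then show "hol_at0 (\<lambda>t. complex_of_real (Re (X t $ i $ j)))" "hol_at0 (\<lambda>t. complex_of_real (Im (X t $ i $ j)))"
    unfolding inner_axis_axis by (simp_all add: inner_complex_def)
qed

lemma hol_mat_if_Re_Im:
  fixes X :: "real \<Rightarrow> 'n::finite cmat"
  assumes "\<And>i j. hol_at0 (\<lambda>t. complex_of_real (Re (X t $ i $ j)))"
    and "\<And>i j. hol_at0 (\<lambda>t. complex_of_real (Im (X t $ i $ j)))"
  shows "hol_mat X"
  unfolding hol_mat_def
proof
  fix v :: "'n cmat"
  have "complex_of_real (X t \<bullet> v) = (\<Sum>i\<in>UNIV. \<Sum>j\<in>UNIV. of_real (Re (X t $ i $ j)) * of_real (Re (v $ i $ j))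
      + of_real (Im (X t $ i $ j)) * of_real (Im (v $ i $ j)))" for t
    by (simp add: inner_vec_def inner_complex_def)
  then show "hol_at0 (\<lambda>t. complex_of_real (X t \<bullet> v))"
    by (simp only:) (intro hol_at0_sum hol_at0_add hol_at0_mult assms hol_at0_const)
qed

lemma hol_mat_nth:
  assumes "hol_mat X"
  shows "hol_at0 (\<lambda>t. X t $ i $ j)"
proof -
  have "X t $ i $ j = of_real (Re (X t $ i $ j)) + \<i> * of_real (Im (X t $ i $ j))" for t
    by (rule complex_eq)
  then show ?thesis
    by (rule ssubst[where P = hol_at0, OF ext])
      (intro hol_at0_add hol_at0_mult hol_at0_const hol_mat_Re_Im[OF assms])
qed

lemma hol_mat_cong:
  assumes "hol_mat X" "0 < e" "\<And>t. \<bar>t\<bar> < e \<Longrightarrow> Y t = X t"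
  shows "hol_mat Y"
  unfolding hol_mat_def
proof
  fix v
  have "hol_at0 (\<lambda>t. complex_of_real (X t \<bullet> v))" using assms(1) unfolding hol_mat_def by blast
  then show "hol_at0 (\<lambda>t. complex_of_real (Y t \<bullet> v))"
    by (rule hol_at0_cong[OF _ assms(2)]) (simp add: assms(3))
qed

text \<open>The square is a polynomial in real and imaginary parts of the entries; the norm itself
  need not be analytic at a zero.\<close>

lemma hol_mat_norm_sq:
  assumes "hol_mat X"
  shows "hol_at0 (\<lambda>t. complex_of_real ((norm (X t))\<^sup>2))"
proof -
  have "complex_of_real ((norm (X t))\<^sup>2) = (\<Sum>i\<in>UNIV. \<Sum>j\<in>UNIV. of_real (Re (X t $ i $ j)) * of_real (Re (X t $ i $ j))
      + of_real (Im (X t $ i $ j)) * of_real (Im (X t $ i $ j)))" for t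
    unfolding norm_cmat_sq cmod_power2 by (simp add: power2_eq_square)
  then show ?thesis
    by (rule ssubst[where P = hol_at0, OF ext])
      (intro hol_at0_sum hol_at0_add hol_at0_mult hol_mat_Re_Im[OF assms])
qed

lemma hol_at0_up_mean:
  assumes "hol_mat B"
  shows "hol_at0 (\<lambda>t. complex_of_real (up_mean k (B t)))"
proof -
  have "complex_of_real (up_mean k (B t)) = (\<Sum>a | idx a < k. of_real (Re (B t $ a $ a))) * of_real (1 / real k)" for t
    by (simp add: up_mean_def)
  then show ?thesis
    by (rule ssubst[where P = hol_at0, OF ext])
      (intro hol_at0_sum hol_at0_mult hol_at0_const hol_mat_Re_Im[OF assms])
qed

lemma hol_mat_up_dev:
  assumes "hol_mat B"
  shows "hol_mat (\<lambda>t. up_dev k (B t))"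
proof (rule hol_mat_if_Re_Im)
  fix i j
  have "complex_of_real (Re (up_dev k (B t) $ i $ j)) = (if idx i < k \<and> idx j < k then 1 else 0) *
      (of_real (Re (B t $ i $ j)) - (if i = j then 1 else 0) * of_real (up_mean k (B t)))" for t
    by (simp add: up_dev_nth)
  then show "hol_at0 (\<lambda>t. complex_of_real (Re (up_dev k (B t) $ i $ j)))"
    by (rule ssubst[where P = hol_at0, OF ext])
      (intro hol_at0_diff hol_at0_mult hol_at0_const hol_at0_up_mean[OF assms] hol_mat_Re_Im[OF assms])
  have "complex_of_real (Im (up_dev k (B t) $ i $ j)) = (if idx i < k \<and> idx j < k then 1 else 0) *
      of_real (Im (B t $ i $ j))" for t
    by (simp add: up_dev_nth)
  then show "hol_at0 (\<lambda>t. complex_of_real (Im (up_dev k (B t) $ i $ j)))"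
    by (rule ssubst[where P = hol_at0, OF ext])
      (intro hol_at0_mult hol_at0_const hol_mat_Re_Im[OF assms])
qed

lemma isCont_of_real_iff: "isCont (\<lambda>t. complex_of_real (f t)) x \<Longrightarrow> isCont f x"
  using continuous_Re by fastforce

lemma hol_mat_isCont:
  assumes "hol_mat X"
  shows "isCont X 0"
  unfolding isCont_def
  using hol_at0_imp_isCont[OF hol_mat_nth[OF assms]] by (intro vec_tendstoI) (simp add: isCont_def)

lemma hol_mat_real_analytic:
  assumes "real_analytic_on1 I H" "0 \<in> I"
  shows "hol_mat H"
  unfolding hol_mat_def using hol_at0_inner_if_real_analytic[OF assms] by blast

text \<open>The Hermitian test direction has nonzero components in all real coordinates except the
  imaginary parts of diagonal entries, which vanish on Herm.\<close>

lemma hol_mat_comp_real_analytic: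
  fixes f :: "('n::{finite,linorder}) cmat \<Rightarrow> 'n cmat"
  assumes f: "real_analytic_on_in Herm V f" and V: "H 0 \<in> V" and H: "hol_mat H"
    and e: "0 < e" "\<And>t. \<bar>t\<bar> < e \<Longrightarrow> H t \<in> Herm"
  shows "hol_mat (\<lambda>t. f (H t))"
proof -
  define D :: "'n cmat" where "D = (\<chi> i j. if i < j then 1 + \<i> else if j < i then 1 - \<i> else 1)"
  have DH: "H 0 + s *\<^sub>R D \<in> Herm" for s
  proof -
    have "herm (H 0)" using e(2)[of 0] e(1) by (simp add: Herm_def)
    then have "madj (H 0) = H 0" by (simp add: herm_iff_madj)
    moreover have "madj (s *\<^sub>R D) = s *\<^sub>R D"
      by (auto simp: vec_eq_iff D_def)
    ultimately show ?thesis by (simp add: Herm_def herm_iff_madj madj_add)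
  qed
  have D0: "(y - H 0) \<bullet> b = 0" if b: "b \<in> Basis" "D \<bullet> b = 0" and y: "y \<in> Herm" for b y
  proof -
    obtain i j u where iju: "b = axis i (axis j u)" "u = 1 \<or> u = \<i>"
      using b(1) unfolding Basis_vec_def by (auto simp: Basis_complex_def)
    have "D $ i $ j \<bullet> u = 0" using b(2) unfolding iju(1) inner_axis_axis .
    then have ij: "i = j" "u = \<i>"
      using iju(2) by (auto simp: D_def inner_complex_def split: if_splits)
    have "Im (y $ i $ i) = 0" "Im (H 0 $ i $ i) = 0"
      using herm_diag_real[of y i] herm_diag_real[of "H 0" i] y e(2)[of 0] e(1)
      by (simp_all add: Herm_def complex_eq_iff)
    then show ?thesis unfolding iju(1) inner_axis_axis ij by (simp add: inner_complex_def)
  qed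
  have "hol_at0 (\<lambda>t. complex_of_real (f (H t) \<bullet> v))" for v
    by (rule hol_at0_comp_real_analytic[where \<gamma> = H, OF f V DH D0 _ e]) (use H in \<open>auto simp: hol_mat_def\<close>)
  then show ?thesis unfolding hol_mat_def by blast
qed

section \<open>Orders of matrix curves as growth of the norm\<close>

lemma bigO0_norm_cmat_iff:
  fixes X :: "real \<Rightarrow> 'n::finite cmat"
  shows "bigO0 (\<lambda>t. norm (X t)) m \<longleftrightarrow> (\<forall>i j. bigO0 (\<lambda>t. X t $ i $ j) m)"
proof (intro iffI allI)
  fix i j assume "bigO0 (\<lambda>t. norm (X t)) m"
  then show "bigO0 (\<lambda>t. X t $ i $ j) m"
    by (rule bigO0_mono[of _ _ 1 _ 1]) (simp_all add: cmod_nth_le_norm)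
next
  assume "\<forall>i j. bigO0 (\<lambda>t. X t $ i $ j) m"
  then have "bigO0 (\<lambda>t. \<Sum>q\<in>UNIV. norm (X t $ fst q $ snd q)) m"
    by (intro bigO0_sum) auto
  then show "bigO0 (\<lambda>t. norm (X t)) m"
  proof (rule bigO0_mono[of _ _ 1 _ 1])
    fix t :: real
    have "norm (X t) \<le> (\<Sum>q\<in>UNIV. norm (X t $ fst q $ snd q))"
      using norm_cmat_le_sum[of "X t"] by (simp add: case_prod_unfold)
    then show "norm (norm (X t)) \<le> 1 * norm (\<Sum>q\<in>UNIV. norm (X t $ fst q $ snd q))"
      by simp
  qed simp_all
qed

lemma bigO0_cong:
  assumes "0 < e" "\<And>t. t \<in> {0..<e} \<Longrightarrow> norm (f t) = c * norm (g t)" "0 < c"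
  shows "bigO0 f m \<longleftrightarrow> bigO0 g m"
proof
  assume "bigO0 f m"
  then show "bigO0 g m"
    by (rule bigO0_mono[OF _ assms(1), of _ _ _ "1 / c"]) (use assms(2,3) in auto)
next
  assume "bigO0 g m"
  then show "bigO0 f m"
    by (rule bigO0_mono[OF _ assms(1), of _ _ _ c]) (use assms(2,3) in auto)
qed

lemma le_ord0_mat_iff:
  fixes X :: "real \<Rightarrow> 'n::finite cmat"
  assumes "hol_mat X"
  shows "enat m \<le> ord0_mat X \<longleftrightarrow> bigO0 (\<lambda>t. norm (X t)) m"
proof -
  have eq: "{ord0 (\<lambda>t. X t $ i $ j) | i j. True} = (\<lambda>q. ord0 (\<lambda>t. X t $ fst q $ snd q)) ` UNIV"
    by (auto simp: image_def)
  have "enat m \<le> ord0 (\<lambda>t. X t $ i $ j) \<longleftrightarrow> bigO0 (\<lambda>t. X t $ i $ j) m" for i j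
  proof -
    obtain a where "has_ps_at0 (\<lambda>t. X t $ i $ j) a"
      using hol_at0_imp_has_ps_at0[OF hol_mat_nth[OF assms, of i j]] by (rule exE)
    then show ?thesis by (rule le_ord0_iff_bigO0)
  qed
  then show ?thesis
    unfolding ord0_mat_def eq bigO0_norm_cmat_iff by (subst Min_ge_iff) auto
qed

theorem mainTheorem7:
  fixes k :: nat and eps0 :: real and delta :: real
    and H :: "real \<Rightarrow> ('n::{finite,linorder}) cmat"
    and H0' :: "'n cmat"
    and V0 :: "('n cmat) set" and U0 :: "('n cmat \<times> 'n cmat) set"
    and Sf Bf :: "'n cmat \<Rightarrow> 'n cmat"
    and E :: "nat \<Rightarrow> 'n cmat"
  assumes "2 \<le> k" and "k \<le> CARD('n) - 1"
    and "eps0 > 0"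
    and "\<forall>t\<in>{-eps0<..<eps0}. H t \<in> Herm"
    and "real_analytic_on1 {-eps0<..<eps0} H"
    and "H 0 \<in> Sigma k"
    and "is_diag H0'" and "\<forall>a b. a \<le> b \<longrightarrow> Re (H0' $ a $ a) \<le> Re (H0' $ b $ b)"
    and "H0' \<in> Sigma k"
    and "SW_data k H0' V0 U0 Sf Bf"
    and "delta > 0" and "\<forall>t. \<bar>t\<bar> < delta \<longrightarrow> H t \<in> V0"
    and "eff_ONB k E"
  shows "ord0 (\<lambda>t. Dk k (H t)) = ord0 (\<lambda>t. infdist (H t) (Sigma k))
       \<and> ord0 (\<lambda>t. infdist (H t) (Sigma k)) = ord0_mat (\<lambda>t. eff_ham k (Bf (H t)))
       \<and> ord0_mat (\<lambda>t. eff_ham k (Bf (H t)))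
           = Min ((\<lambda>j. ord0 (\<lambda>t. E j \<bullet> eff_ham k (Bf (H t)))) ` {1..k\<^sup>2-1})"
proof -
  have k: "1 \<le> k" "k \<le> CARD('n)" "k < CARD('n)" using assms(1,2) zero_less_card_finite[where 'a = 'n] by linarith+
  have herm0: "herm H0'" using assms(9) by (simp add: Sigma_def)
  obtain e where e: "\<And>a. idx a < k \<Longrightarrow> H0' $ a $ a = of_real e"
    using diag_Sigma_upper[OF assms(7) _ assms(9) k(1,3)] assms(8) by blast
  define B where "B = (\<lambda>t. Bf (H t))"
  define K where "K = (\<lambda>t. eff_ham k (B t))"
  define A where "A = {a :: 'n. idx a < k}"
  have cardA: "card A = k" unfolding A_def by (rule card_idx_less[OF k(2)])

  \<comment> \<open>Spectral data at each parameter value\<close>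
  have "\<exists>W U m. unitary W \<and> block_unitary k U \<and>
      H0' + B t = U ** dg (\<lambda>a. complex_of_real (m a)) ** madj U \<and>
      H t = W ** (H0' + B t) ** madj W \<and>
      image_mset m (mset_set A) = mset (take k (eigvals (H t))) \<and>
      (\<forall>a b. a \<in> A \<longrightarrow> b \<notin> A \<longrightarrow> m a < m b) \<and>
      herm (B t) \<and> block_diag k (B t) \<and> length (eigvals (H t)) = CARD('n)" if t: "\<bar>t\<bar> < delta" for t
  proof -
    have V: "H t \<in> V0" using t assms(12) by blast
    show ?thesis
      by (rule SW_spectral[OF assms(10) V herm0 assms(7) k(1,2)]) (unfold B_def A_def mem_Collect_eq, blast)
  qed
  then have "\<forall>t. \<exists>W U m. \<bar>t\<bar> < delta \<longrightarrow> unitary W \<and> block_unitary k U \<and>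
      H0' + B t = U ** dg (\<lambda>a. complex_of_real (m a)) ** madj U \<and>
      H t = W ** (H0' + B t) ** madj W \<and>
      image_mset m (mset_set A) = mset (take k (eigvals (H t))) \<and>
      (\<forall>a b. a \<in> A \<longrightarrow> b \<notin> A \<longrightarrow> m a < m b) \<and>
      herm (B t) \<and> block_diag k (B t) \<and> length (eigvals (H t)) = CARD('n)" by blast
  then obtain W U m where
    "\<forall>t. \<bar>t\<bar> < delta \<longrightarrow> unitary (W t) \<and> block_unitary k (U t) \<and>
      H0' + B t = U t ** dg (\<lambda>a. complex_of_real (m t a)) ** madj (U t) \<and>
      H t = W t ** (H0' + B t) ** madj (W t) \<and>
      image_mset (m t) (mset_set A) = mset (take k (eigvals (H t))) \<and>
      (\<forall>a b. a \<in> A \<longrightarrow> b \<notin> A \<longrightarrow> m t a < m t b) \<and>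
      herm (B t) \<and> block_diag k (B t) \<and> length (eigvals (H t)) = CARD('n)"
    unfolding choice_iff by blast
  then have W: "unitary (W t)" and U: "block_unitary k (U t)"
    and M: "H0' + B t = U t ** dg (\<lambda>a. complex_of_real (m t a)) ** madj (U t)"
    and HM: "H t = W t ** (H0' + B t) ** madj (W t)"
    and low: "image_mset (m t) (mset_set A) = mset (take k (eigvals (H t)))"
    and less: "\<And>a b. a \<in> A \<Longrightarrow> b \<notin> A \<Longrightarrow> m t a < m t b"
    and B: "herm (B t)" "block_diag k (B t)" and len: "k \<le> length (eigvals (H t))"
    if "\<bar>t\<bar> < delta" for t
    using that k(2) by auto

  \<comment> \<open>The effective Hamiltonian in terms of the upper-block eigenvalues\<close>
  have K: "K t = up_dev k (B t)" if "\<bar>t\<bar> < delta" for t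
    unfolding K_def by (rule eff_ham_eq[OF B[OF that] k(1,2)])
  have KM: "K t = up_dev k (H0' + B t)" if "\<bar>t\<bar> < delta" for t
    unfolding K[OF that] by (rule up_dev_shift[OF assms(7) e k(1,2), symmetric])
  define c where "c = (\<lambda>t. up_mean k (H0' + B t))"
  have c: "c t = e + up_mean k (B t)" for t
    unfolding c_def by (rule up_mean_shift[OF e k(1,2)])
  have Dk: "Dk k (H t) = norm (K t) / sqrt (real k)" if t: "\<bar>t\<bar> < delta" for t
    unfolding KM[OF t] by (rule Dk_eq_norm_up_dev[OF U[OF t] M[OF t] low[OF t, unfolded A_def] len[OF t]])
  have normK: "(norm (K t))\<^sup>2 = (\<Sum>a\<in>A. (m t a - c t)\<^sup>2)" if t: "\<bar>t\<bar> < delta" for t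
    unfolding KM[OF t] c_def M[OF t] A_def by (rule norm_up_dev_conj_dg[OF U[OF t]])
  have mean: "(\<Sum>a\<in>A. m t a) = real k * c t" if t: "\<bar>t\<bar> < delta" for t
    unfolding c_def M[OF t] up_mean_conj_dg[OF U[OF t]] A_def using k(1) by simp

  define d where "d = min delta eps0"
  have d: "0 < d" "d \<le> delta" "d \<le> eps0" using assms(3,11) by (simp_all add: d_def)
  have "hol_mat B"
    unfolding B_def
  proof (rule hol_mat_comp_real_analytic[where H = H])
    show "real_analytic_on_in Herm V0 Bf" using assms(10) unfolding SW_data_def by blast
    show "H 0 \<in> V0" using assms(11,12) by simp
    show "hol_mat H" by (rule hol_mat_real_analytic[OF assms(5)]) (use assms(3) in simp)
    show "0 < eps0" by fact
    show "H t \<in> Herm" if "\<bar>t\<bar> < eps0" for t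
      by (rule bspec[OF assms(4)]) (use that in \<open>simp add: abs_less_iff\<close>)
  qed
  have "hol_mat K"
    by (rule hol_mat_cong[OF hol_mat_up_dev[OF \<open>hol_mat B\<close>] assms(11) K])

  \<comment> \<open>The gap and the distance formula near 0\<close>
  have K0: "K 0 = 0"
  proof -
    \<comment> \<open>\<open>H 0\<close> in \<open>Sigma k\<close> makes the k lowest eigenvalues
      equal their mean, so the splitting at 0 vanishes, and with it K 0.\<close>
    have eq: "lam (H 0) j = lam (H 0) 1" if "j \<in> {1..k}" for j using assms(6) that unfolding Sigma_def by blast
    have "Dk k (H 0) = 0"
    proof -
      have "(\<Sum>j=1..k. lam (H 0) j) = (\<Sum>j=1..k. lam (H 0) 1)" by (rule sum.cong[OF refl eq])
      then have mn: "(\<Sum>j=1..k. lam (H 0) j) / real k = lam (H 0) 1" using k by simp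
      have "(\<Sum>j=1..k. (lam (H 0) j - lam (H 0) 1)\<^sup>2) = 0"
        by (intro sum.neutral ballI) (simp only: eq diff_self zero_power2)
      then show ?thesis unfolding Dk_def Let_def mn by simp
    qed
    then show ?thesis using Dk[of 0] assms(11) k(1) by simp
  qed
  have A0: "A \<noteq> {}" using cardA k by auto
  have delta0: "\<bar>0::real\<bar> < delta" using assms(11) by simp
  have m0: "m 0 a = c 0" if "a \<in> A" for a
  proof -
    have "(\<Sum>a\<in>A. (m 0 a - c 0)\<^sup>2) = 0" using normK[OF delta0] K0 by simp
    then have "(m 0 a - c 0)\<^sup>2 = 0" using that by (subst (asm) sum_nonneg_eq_0_iff) auto
    then show ?thesis by simp
  qed
  have Ac: "\<exists>b. b \<notin> A"
  proof (rule ccontr)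
    assume "\<nexists>b. b \<notin> A"
    then have "A = UNIV" by blast
    then show False using cardA k(3) by simp
  qed
  \<comment> \<open>The smallest lower-block eigenvalue at t = 0, the reference for the gap at all
    nearby t.\<close>
  define g where "g = Min (m 0 ` (- A))"
  have g: "g \<le> m 0 b" if "b \<notin> A" for b using that by (simp add: g_def)
  have "g \<in> m 0 ` (- A)" unfolding g_def using Ac by (intro Min_in) auto
  then have cg: "c 0 < g" using less[OF delta0] m0 A0 by fastforce

  \<comment> \<open>g minus the perturbation of B bounds the lower eigenvalues at t from below, and
    e plus the mean of B t is c t. At t = 0 the expression is g - c 0 > 0, so by continuity the gap
    with factor 5 persists.\<close>
  have "isCont (\<lambda>t. g - norm (B t - B 0) - (e + up_mean k (B t)) - 5 * norm (K t)) 0"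
    by (intro continuous_intros hol_mat_isCont[OF \<open>hol_mat B\<close>] hol_mat_isCont[OF \<open>hol_mat K\<close>]
        isCont_of_real_iff[OF hol_at0_imp_isCont[OF hol_at0_up_mean[OF \<open>hol_mat B\<close>]]])
  moreover have "0 < g - norm (B 0 - B 0) - (e + up_mean k (B 0)) - 5 * norm (K 0)"
    using cg c[of 0] K0 by simp
  ultimately have "\<forall>\<^sub>F t in at 0. 0 < g - norm (B t - B 0) - (e + up_mean k (B t)) - 5 * norm (K t)"
    unfolding isCont_def by (rule order_tendstoD)
  then obtain s where s: "0 < s" "\<And>t. t \<noteq> 0 \<Longrightarrow> \<bar>t\<bar> < s \<Longrightarrow> 0 < g - norm (B t - B 0) - (e + up_mean k (B t)) - 5 * norm (K t)"
    unfolding eventually_at by (auto simp: dist_real_def)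
  have gap: "c t + 5 * norm (K t) \<le> g - norm (B t - B 0)" if "\<bar>t\<bar> < s" for t
  proof (cases "t = 0")
    case True
    then show ?thesis using cg K0 by simp
  next
    case False
    then show ?thesis using s(2)[OF False that] unfolding c by simp
  qed
  have dist: "infdist (H t) (Sigma k) = norm (K t)" if t: "\<bar>t\<bar> < min s delta" for t
  proof -
    have ts: "\<bar>t\<bar> < s" and td: "\<bar>t\<bar> < delta" using t by auto
    have unU: "unitary (U t)" using U[OF td] by (simp add: block_unitary_def)
    have Ht: "H t = (W t ** U t) ** dg (\<lambda>a. of_real (m t a)) ** madj (W t ** U t)"
      by (subst HM[OF td]) (simp only: M[OF td] madj_mult matrix_mul_assoc)
    have low: "c t + 5 * norm (K t) \<le> m t b" if b: "b \<notin> A" for b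
    proof -
      have "g - norm ((H0' + B t) - (H0' + B 0)) \<le> m t b"
        unfolding M[OF td] M[OF delta0]
        by (rule lower_block_eigenvalue_ge[OF U[OF td] U[OF delta0]]) (use g b in \<open>simp_all add: A_def\<close>)
      then show ?thesis using gap[OF ts] by simp
    qed
    \<comment> \<open>Strictness comes from averaging: each upper eigenvalue lies below m t b, hence
      so does their mean.\<close>
    have cm: "c t < m t b" if b: "b \<notin> A" for b
    proof -
      have "real k * c t < (\<Sum>a\<in>A. m t b)"
        unfolding mean[OF td, symmetric] by (rule sum_strict_mono) (use A0 less[OF td _ b] in auto)
      then show ?thesis using cardA k(1) by simp
    qed
    show ?thesis unfolding Ht
      by (rule infdist_Sigma[OF unitary_mult[OF W[OF td] unU] cardA k(1,3) mean[OF td] norm_ge_zero normK[OF td] low cm])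
  qed

  \<comment> \<open>Existence of the power series and growth of the four quantities\<close>
  have holN: "hol_at0 (\<lambda>t. complex_of_real ((norm (K t))\<^sup>2))" by (rule hol_mat_norm_sq[OF \<open>hol_mat K\<close>])
  have "hol_at0 (\<lambda>t. complex_of_real ((norm (K t))\<^sup>2 / real k))"
    using hol_at0_mult[OF holN hol_at0_const[of "1 / of_nat k"]] by simp
  from has_ps_at0_sqrt[OF this zero_less_one] obtain a1 where "has_ps_at0 (\<lambda>t. sqrt ((norm (K t))\<^sup>2 / real k)) a1" by auto
  then have psD: "has_ps_at0 (\<lambda>t. Dk k (H t)) a1"
    by (rule has_ps_at0_cong[OF _ assms(11)]) (simp add: Dk real_sqrt_divide)
  from has_ps_at0_sqrt[OF holN zero_less_one] obtain a2 where "has_ps_at0 (\<lambda>t. sqrt ((norm (K t))\<^sup>2)) a2" by auto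
  then have psI: "has_ps_at0 (\<lambda>t. infdist (H t) (Sigma k)) a2"
    by (rule has_ps_at0_cong[of _ _ "min s delta"]) (use s(1) assms(11) in \<open>auto simp: dist\<close>)

  \<comment> \<open>Each order is expressed by growth of the same function, the norm of K; the
    constant factor 1 / \<open>sqrt (real k)\<close> is harmless.\<close>
  have 1: "enat r \<le> ord0 (\<lambda>t. Dk k (H t)) \<longleftrightarrow> bigO0 (\<lambda>t. norm (K t)) r" for r
    unfolding le_ord0_iff_bigO0[OF psD]
    by (rule bigO0_cong[OF assms(11), of _ "1 / sqrt (real k)"]) (use k(1) in \<open>simp_all add: Dk\<close>)
  have 2: "enat r \<le> ord0 (\<lambda>t. infdist (H t) (Sigma k)) \<longleftrightarrow> bigO0 (\<lambda>t. norm (K t)) r" for r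
    unfolding le_ord0_iff_bigO0[OF psI]
    by (rule bigO0_cong[of "min s delta" _ 1]) (use s(1) assms(11) in \<open>simp_all add: dist\<close>)
  have 3: "enat r \<le> ord0_mat K \<longleftrightarrow> bigO0 (\<lambda>t. norm (K t)) r" for r
    by (rule le_ord0_mat_iff[OF \<open>hol_mat K\<close>])

  define J where "J = {1..k\<^sup>2 - 1}"
  \<comment> \<open>k >= 2 makes the index set of coordinates nonempty, so that the minimum over it
    is meaningful.\<close>
  have "2 * 2 \<le> k * k" using assms(1) by (intro mult_le_mono)
  then have J: "finite J" "J \<noteq> {}" by (auto simp: J_def power2_eq_square)
  have on: "E i \<bullet> E j = (if i = j then 1 else 0)" if "i \<in> J" "j \<in> J" for i j
    using assms(13) that unfolding eff_ONB_def J_def by blast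
  have Kspan: "K t \<in> span (E ` J)" if t: "\<bar>t\<bar> < delta" for t
  proof -
    have "K t \<in> eff_space k"
      unfolding K[OF t] eff_space_def
      using herm_up_dev[OF B(1)[OF t]] upper_left_up_dev mtrace_up_dev[OF B(1)[OF t] k(1,2)] by blast
    then show ?thesis using assms(13) unfolding eff_ONB_def J_def by blast
  qed
  have coord: "enat r \<le> ord0 (\<lambda>t. E j \<bullet> K t) \<longleftrightarrow> bigO0 (\<lambda>t. E j \<bullet> K t) r" for r j
  proof -
    have "hol_at0 (\<lambda>t. complex_of_real (E j \<bullet> K t))"
      using \<open>hol_mat K\<close> unfolding hol_mat_def by (subst inner_commute) blast
    then obtain a where "has_ps_at0 (\<lambda>t. E j \<bullet> K t) a"
      using hol_at0_real_imp_has_ps_at0[of "\<lambda>t. E j \<bullet> K t"] by (auto elim: exE)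
    then show ?thesis by (rule le_ord0_iff_bigO0)
  qed
  have 4: "enat r \<le> Min ((\<lambda>j. ord0 (\<lambda>t. E j \<bullet> K t)) ` J) \<longleftrightarrow> bigO0 (\<lambda>t. norm (K t)) r" for r
  proof -
    have "enat r \<le> Min ((\<lambda>j. ord0 (\<lambda>t. E j \<bullet> K t)) ` J) \<longleftrightarrow> (\<forall>j\<in>J. bigO0 (\<lambda>t. E j \<bullet> K t) r)"
      using J coord by (subst Min_ge_iff) auto
    also have "\<dots> \<longleftrightarrow> bigO0 (\<lambda>t. norm (K t)) r"
    proof (intro iffI ballI)
      fix j assume j: "j \<in> J" and O: "bigO0 (\<lambda>t. norm (K t)) r"
      have "norm (E j) = 1" using on[OF j j] by (simp add: norm_eq_sqrt_inner)
      then show "bigO0 (\<lambda>t. E j \<bullet> K t) r"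
        by (intro bigO0_mono[OF O zero_less_one, of _ 1]) (use Cauchy_Schwarz_ineq2[of "E j"] in auto)
    next
      assume "\<forall>j\<in>J. bigO0 (\<lambda>t. E j \<bullet> K t) r"
      then have "bigO0 (\<lambda>t. \<Sum>j\<in>J. norm (E j \<bullet> K t)) r" using J(1) by (intro bigO0_sum) auto
      then show "bigO0 (\<lambda>t. norm (K t)) r"
      proof (rule bigO0_mono[OF _ assms(11), of _ _ _ 1])
        fix t assume "t \<in> {0..<delta}"
        then have "norm (K t) \<le> (\<Sum>j\<in>J. \<bar>E j \<bullet> K t\<bar>)"
          by (intro norm_le_sum_coordinates[OF J(1) on Kspan]) auto
        then show "norm (norm (K t)) \<le> 1 * norm (\<Sum>j\<in>J. norm (E j \<bullet> K t))" by simp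
      qed simp
    qed
    finally show ?thesis .
  qed
  have "ord0 (\<lambda>t. Dk k (H t)) = ord0 (\<lambda>t. infdist (H t) (Sigma k))"
    "ord0 (\<lambda>t. infdist (H t) (Sigma k)) = ord0_mat K"
    "ord0_mat K = Min ((\<lambda>j. ord0 (\<lambda>t. E j \<bullet> K t)) ` J)"
    unfolding enat_eq_iff_le 1 2 3 4 by blast+
  then show ?thesis unfolding K_def B_def J_def by blast
qed

end
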